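(* Let $F$ be a global field, let $p$ be an odd prime with $p\neq\operatorname{char}F$, and assume $\mu_p\subset F$. Let $a,b,c,d,x,y\in F^\times$ satisfy \[(a,b)_p=(x^{-1},b)_p=(x,y)_p=(c^{-1},y)_p=(c,d)_p \quad\text{in } \operatorname{Br}(F)[p].\] Then the following four norm relations hold: \begin{align*} ax &\in N_{F(\sqrt[p]{b})/F}\bigl(F(\sqrt[p]{b})^\times\bigr),\\ x^{-1} &\in N_{F(\sqrt[p]{by})/F}\bigl(F(\sqrt[p]{by})^\times\bigr),\\ y^{-1} &\in N_{F(\sqrt[p]{xc})/F}\bigl(F(\sqrt[p]{xc})^\times\bigr),\\ yd &\in N_{F(\sqrt[p]{c})/F}\bigl(F(\sqrt[p]{c})^\times\bigr). \end{align*}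
   Context: $\mu_p$ denotes the group of $p$-th roots of unity; $\mu_p\subset F$ means $F$ contains a primitive $p$-th root of unity $\zeta$, which is fixed. For $u,v\in F^\times$, $(u,v)_p$ denotes the class in the $p$-torsion $\operatorname{Br}(F)[p]$ (written additively) of the degree-$p$ symbol algebra over $F$ generated by $i,j$ with $i^p=u$, $j^p=v$, $ji=\zeta ij$. All equalities between symbols are equalities of Brauer classes. $N_{E/F}$ denotes the field norm of a finite extension $E/F$ (if $u$ is a $p$-th power in $F$, then $F(\sqrt[p]{u})=F$ and the norm is the identity). *)

theory Defs
  imports
    "HOL-Algebra.Algebraic_Closure_Type"
    "HOL-Algebra.Generated_Fields"
    "HOL-Algebra.Finite_Extensions"
    "HOL-Algebra.QuotRing"
    "HOL-Algebra.Module"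
    "Jordan_Normal_Form.Determinant"
begin

text \<open>
  A field \<open>F\<close> is a type of class \<open>field\<close>; \<open>field_ring\<close> is the same field as an object of
  HOL-Algebra, so that the library's notions of subfield, dimension and transcendence apply.
\<close>

abbreviation field_ring :: "'a::field ring"
  where "field_ring \<equiv> ring_of_type_algebra"


section \<open>Global fields\<close>

text \<open>
  In characteristic \<open>0\<close>, the field generated by the empty set is the prime field \<open>\<rat>\<close>.
\<close>

definition number_field :: "'a::field itself \<Rightarrow> bool"
  where "number_field _ \<longleftrightarrow>
    CHAR('a) = 0 \<and>
    ring.finite_dimension field_ring (generate_field field_ring {}) (UNIV :: 'a set)"

definition global_function_field :: "'a::field itself \<Rightarrow> bool"
  where "global_function_field _ \<longleftrightarrow>
    (\<exists>k (t :: 'a). subfield k field_ring \<and> finite k \<and>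
       ring.transcendental field_ring k t \<and>
       ring.finite_dimension field_ring (generate_field field_ring (insert t k)) UNIV)"

definition global_field :: "'a::field itself \<Rightarrow> bool"
  where "global_field T \<longleftrightarrow> number_field T \<or> global_function_field T"

definition primitive_root_of_unity :: "nat \<Rightarrow> 'a::field \<Rightarrow> bool"
  where "primitive_root_of_unity n \<zeta> \<longleftrightarrow>
    n > 0 \<and> \<zeta> ^ n = 1 \<and> (\<forall>k. 0 < k \<and> k < n \<longrightarrow> \<zeta> ^ k \<noteq> 1)"


section \<open>Radical extensions and norms\<close>

text \<open>
  All finite extensions of \<open>F\<close> are taken inside the library's algebraic closure of \<open>F\<close>, viewed
  as a vector space over \<open>F\<close>.
\<close>

definition ac_scale :: "'a::field \<Rightarrow> 'a alg_closure \<Rightarrow> 'a alg_closure"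
  where "ac_scale c z = to_ac c * z"

global_interpretation ac: vector_space "ac_scale :: 'a::field \<Rightarrow> 'a alg_closure \<Rightarrow> 'a alg_closure"
  defines ac_span = ac.span
    and ac_dependent = ac.dependent
    and ac_representation = ac.representation
  by unfold_locales (simp_all add: ac_scale_def algebra_simps)

text \<open>
  The root is an arbitrary one in the algebraic closure.  If the base field contains the
  \<open>n\<close>-th roots of unity, the extension does not depend on it.
\<close>

definition root_extension :: "nat \<Rightarrow> 'a::field \<Rightarrow> 'a alg_closure set"
  where "root_extension n b =
    generate_field field_ring (insert (SOME r. r ^ n = to_ac b) (range to_ac))"

definition extension_basis :: "'a::field alg_closure set \<Rightarrow> 'a alg_closure list \<Rightarrow> bool"
  where "extension_basis E bs \<longleftrightarrow>
    distinct bs \<and> \<not> ac_dependent (set bs) \<and> ac_span (set bs) = E"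

text \<open>
  The norm of \<open>z\<close> is the determinant of the \<open>F\<close>-linear map \<open>w \<mapsto> z w\<close> on \<open>E\<close>, computed in an
  arbitrarily chosen basis.
\<close>

definition field_norm :: "'a::field alg_closure set \<Rightarrow> 'a alg_closure \<Rightarrow> 'a"
  where "field_norm E z =
    (let bs = (SOME bs. extension_basis E bs); n = length bs in
     det (mat n n (\<lambda>(i, j). ac_representation (set bs) (z * bs ! j) (bs ! i))))"

definition norm_group :: "'a::field alg_closure set \<Rightarrow> 'a set"
  where "norm_group E = field_norm E ` (E - {0})"


section \<open>Algebras over a field\<close>

text \<open>
  The library's locale \<open>algebra\<close> is restricted to commutative algebras.
\<close>

definition assoc_algebra :: "('a::field, 'b) module \<Rightarrow> bool"
  where "assoc_algebra A \<longleftrightarrow>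
    ring A \<and> module field_ring A \<and>
    (\<forall>c. \<forall>x\<in>carrier A. \<forall>y\<in>carrier A.
       (c \<odot>\<^bsub>A\<^esub> x) \<otimes>\<^bsub>A\<^esub> y = c \<odot>\<^bsub>A\<^esub> (x \<otimes>\<^bsub>A\<^esub> y) \<and>
       x \<otimes>\<^bsub>A\<^esub> (c \<odot>\<^bsub>A\<^esub> y) = c \<odot>\<^bsub>A\<^esub> (x \<otimes>\<^bsub>A\<^esub> y))"

definition scalars :: "('a::field, 'b) module \<Rightarrow> 'b set"
  where "scalars A = range (\<lambda>c. c \<odot>\<^bsub>A\<^esub> \<one>\<^bsub>A\<^esub>)"

definition algebra_center :: "('a::field, 'b) module \<Rightarrow> 'b set"
  where "algebra_center A = {z \<in> carrier A. \<forall>x\<in>carrier A. z \<otimes>\<^bsub>A\<^esub> x = x \<otimes>\<^bsub>A\<^esub> z}"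

definition central_simple_algebra :: "('a::field, 'b) module \<Rightarrow> bool"
  where "central_simple_algebra A \<longleftrightarrow>
    assoc_algebra A \<and>
    ring.finite_dimension A (scalars A) (carrier A) \<and>
    algebra_center A = scalars A \<and>
    carrier A \<noteq> {\<zero>\<^bsub>A\<^esub>} \<and>
    (\<forall>I. ideal I A \<longrightarrow> I = {\<zero>\<^bsub>A\<^esub>} \<or> I = carrier A)"

definition algebra_isomorphic :: "('a::field, 'b) module \<Rightarrow> ('a, 'c) module \<Rightarrow> bool"
  where "algebra_isomorphic A B \<longleftrightarrow>
    (\<exists>h\<in>ring_iso A B. \<forall>c. \<forall>x\<in>carrier A. h (c \<odot>\<^bsub>A\<^esub> x) = c \<odot>\<^bsub>B\<^esub> h x)"

text \<open>
  Matrices with entries in \<open>A\<close> are extensional functions on pairs of indices.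
\<close>

definition matrix_algebra ::
    "nat \<Rightarrow> ('a::field, 'b) module \<Rightarrow> ('a, nat \<times> nat \<Rightarrow> 'b) module"
  where "matrix_algebra n A =
    (let I = {..<n} \<times> {..<n} in
     \<lparr> partial_object.carrier = I \<rightarrow>\<^sub>E carrier A,
       monoid.mult = (\<lambda>M N. \<lambda>(i, j)\<in>I. \<Oplus>\<^bsub>A\<^esub>k\<in>{..<n}. M (i, k) \<otimes>\<^bsub>A\<^esub> N (k, j)),
       monoid.one = (\<lambda>(i, j)\<in>I. if i = j then \<one>\<^bsub>A\<^esub> else \<zero>\<^bsub>A\<^esub>),
       ring.zero = (\<lambda>ij\<in>I. \<zero>\<^bsub>A\<^esub>),
       ring.add = (\<lambda>M N. \<lambda>ij\<in>I. M ij \<oplus>\<^bsub>A\<^esub> N ij),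
       module.smult = (\<lambda>c M. \<lambda>ij\<in>I. c \<odot>\<^bsub>A\<^esub> M ij) \<rparr>)"


section \<open>Brauer classes and symbols\<close>

text \<open>
  Every finite-dimensional algebra over \<open>F\<close> is isomorphic to one whose underlying set consists
  of functions \<open>nat \<times> nat \<Rightarrow> F\<close>, so the Brauer group of \<open>F\<close> is the quotient by the following
  relation of the central simple algebras with carrier in this type.
\<close>

type_synonym 'a fun_algebra = "('a, nat \<times> nat \<Rightarrow> 'a) module"

definition brauer_rel :: "('a::field fun_algebra \<times> 'a fun_algebra) set"
  where "brauer_rel =
    {(A, B). central_simple_algebra A \<and> central_simple_algebra B \<and>
       (\<exists>m n. m > 0 \<and> n > 0 \<and>
          algebra_isomorphic (matrix_algebra m A) (matrix_algebra n B))}"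

definition brauer_group :: "'a::field fun_algebra set set"
  where "brauer_group = {A. central_simple_algebra A} // brauer_rel"

definition brauer_class :: "'a::field fun_algebra \<Rightarrow> 'a fun_algebra set"
  where "brauer_class A = brauer_rel `` {A}"

text \<open>
  The symbol algebra has the basis \<open>i^k j^l\<close> with \<open>k, l < p\<close>, and an element is identified with
  its family of coefficients.  The relations \<open>i^p = u\<close>, \<open>j^p = v\<close>, \<open>j i = \<zeta> i j\<close> give
  \<open>i^k j^l \<cdot> i^m j^n = \<zeta>^(l m) i^(k+m) j^(l+n)\<close>, whose exponents are then reduced modulo \<open>p\<close>.
\<close>

definition symbol_algebra :: "nat \<Rightarrow> 'a::field \<Rightarrow> 'a \<Rightarrow> 'a \<Rightarrow> 'a fun_algebra"
  where "symbol_algebra p \<zeta> u v =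
    \<lparr> partial_object.carrier = {f. \<forall>k l. (k, l) \<notin> {..<p} \<times> {..<p} \<longrightarrow> f (k, l) = 0},
      monoid.mult = (\<lambda>f g (r, s).
        \<Sum>k<p. \<Sum>l<p. \<Sum>m<p. \<Sum>n<p.
          if (k + m) mod p = r \<and> (l + n) mod p = s
          then f (k, l) * g (m, n) * \<zeta> ^ (l * m) * u ^ ((k + m) div p) * v ^ ((l + n) div p)
          else 0),
      monoid.one = (\<lambda>(k, l). if k = 0 \<and> l = 0 then 1 else 0),
      ring.zero = (\<lambda>_. 0),
      ring.add = (\<lambda>f g kl. f kl + g kl),
      module.smult = (\<lambda>c f kl. c * f kl) \<rparr>"

definition symbol :: "nat \<Rightarrow> 'a::field \<Rightarrow> 'a \<Rightarrow> 'a \<Rightarrow> 'a fun_algebra set"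
  where "symbol p \<zeta> u v = brauer_class (symbol_algebra p \<zeta> u v)"

end

theory Submission
  imports Defs "HOL-Library.Function_Algebras"
begin

text \<open>Write \<open>(u, v)\<close> for the symbol algebra with generators \<open>i\<close>, \<open>j\<close>.  In the Brauer group the claims
are immediate: bilinearity turns each of the four equalities of symbols into the vanishing of one
symbol, and a symbol \<open>(\<alpha>, \<beta>)\<close> vanishes iff \<open>\<beta>\<close> is a norm from \<open>F(\<alpha>\<^sup>1\<^sup>/\<^sup>p)\<close>.  The proof below avoids
tensor products, Skolem--Noether and Wedderburn's theorem by working with one bimodule.

An isomorphism of \<open>M\<^sub>m(A)\<close> with \<open>M\<^sub>n(B)\<close>, for \<open>A = (u, v)\<close> and \<open>B = (u', v')\<close>, makes the column space
\<open>B\<^sup>n\<close> a left \<open>M\<^sub>m(A)\<close>-module and a right \<open>B\<close>-module.  Cutting with a diagonal matrix unit leaves a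
nonzero space \<open>W\<close> of dimension at most \<open>p\<^sup>2\<close> (if \<open>n \<le> m\<close>, which may be assumed), on which the
generators of \<open>A\<close> act from the left and those of \<open>B\<close> from the right (\<open>symbol_bimodule\<close>).  These are two
pairs of operators, each commuting up to a root of unity, and every operator of one pair commutes
with every operator of the other.

If \<open>u u' = 1\<close>, then \<open>T = i\<^sub>A i\<^sub>B\<close> satisfies \<open>T\<^sup>p = 1\<close>, so \<open>T\<close> has an eigenvector.  The powers of \<open>j\<^sub>A\<close>
move its eigenspace \<open>V\<close> to \<open>p\<close> different eigenspaces, hence \<open>dim V \<le> p\<close>.  The operators
\<open>J = i\<^sub>A\<close> and \<open>\<Phi> = j\<^sub>A j\<^sub>B\<close> preserve \<open>V\<close> and satisfy \<open>J\<^sup>p = u\<close>, \<open>\<Phi>\<^sup>p = v v'\<close>, \<open>\<Phi> J = \<zeta> J \<Phi>\<close>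
(\<open>norm_of_commuting_pairs\<close>).  This replaces the bilinearity of the symbol.  The case \<open>v = v'\<close> is the same
after passing to inverse operators.

Such a pair on a nonzero space of dimension at most \<open>p\<close> exhibits a norm (\<open>norm_of_split_pair\<close>).
If \<open>u\<close> is not a \<open>p\<close>-th power, then \<open>V\<close> has the basis \<open>s, J s, \<dots>, J\<^sup>p\<^sup>-\<^sup>1 s\<close> for every nonzero \<open>s\<close>.  So
\<open>\<Phi> s = q(J) s\<close> for a polynomial \<open>q\<close>, and iterating,
\<open>v v' s = \<Phi>\<^sup>p s = q(J) q(\<zeta> J) \<cdots> q(\<zeta>\<^sup>p\<^sup>-\<^sup>1 J) s\<close>.  The same product
with the root \<open>r\<close> of \<open>u\<close> in place of \<open>J\<close> is the norm of \<open>q(r)\<close> (\<open>field_norm_eval\<close>).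
If \<open>u\<close> is a \<open>p\<close>-th power, every nonzero element is a norm.
Exchanging the roles of \<open>\<Phi>\<close> and \<open>J\<close> gives the relations in which the extension is generated by
a root of a product.\<close>

section \<open>Roots of unity\<close>

lemma primitive_root_inverse:
  assumes "primitive_root_of_unity n (z :: 'a::field)"
  shows "primitive_root_of_unity n (inverse z)"
  using assms by (auto simp: primitive_root_of_unity_def power_inverse)

lemma primitive_root_nonzero:
  assumes "primitive_root_of_unity n (z :: 'a::field)"
  shows "z \<noteq> 0"
  using assms by (auto simp: primitive_root_of_unity_def power_0_left split: if_splits)

lemma primitive_root_power_mod:
  assumes "primitive_root_of_unity n (z :: 'a::field)"
  shows "z ^ (k mod n) = z ^ k"
proof -
  have "z ^ k = z ^ (n * (k div n) + k mod n)" by simp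
  also have "\<dots> = (z ^ n) ^ (k div n) * z ^ (k mod n)" by (simp only: power_add power_mult)
  finally show ?thesis using assms by (simp add: primitive_root_of_unity_def)
qed

lemma primitive_root_inj:
  assumes "primitive_root_of_unity n (z :: 'a::field)"
  shows "inj_on (\<lambda>k. z ^ k) {..<n}"
proof (rule linorder_inj_onI)
  fix i j assume ij: "i < j" "i \<in> {..<n}" "j \<in> {..<n}"
  show "z ^ i \<noteq> z ^ j"
  proof
    assume eq: "z ^ i = z ^ j"
    have "z ^ j = z ^ i * z ^ (j - i)" using ij by (simp flip: power_add)
    with eq primitive_root_nonzero[OF assms] have "z ^ (j - i) = 1" by simp
    then show False using assms ij by (auto simp: primitive_root_of_unity_def)
  qed
qed auto

lemma roots_of_unity_eq_powers:
  assumes "primitive_root_of_unity n (z :: 'a::field)" "u ^ n = 1"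
  shows "\<exists>k<n. u = z ^ k"
proof -
  let ?P = "monom 1 n - 1 :: 'a poly"
  have n: "n > 0" using assms by (simp add: primitive_root_of_unity_def)
  have coeffn: "coeff ?P n = 1" using n by (simp add: one_pCons coeff_pCons split: nat.splits)
  then have nz: "?P \<noteq> 0" by (metis coeff_0 zero_neq_one)
  have "degree ?P \<le> n"
    by (rule degree_diff_le) (auto simp: degree_monom_le)
  then have card: "card {x. poly ?P x = 0} \<le> n"
    using card_poly_roots_bound[OF nz] by simp
  have fin: "finite {x. poly ?P x = 0}" using nz by (rule poly_roots_finite)
  have sub: "(\<lambda>k. z ^ k) ` {..<n} \<subseteq> {x. poly ?P x = 0}"
    using assms(1) by (auto simp: poly_monom primitive_root_of_unity_def simp flip: power_mult)
      (metis mult.commute power_mult power_one)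
  have "card ((\<lambda>k. z ^ k) ` {..<n}) = n"
    using primitive_root_inj[OF assms(1)] by (simp add: card_image)
  with card sub fin have "(\<lambda>k. z ^ k) ` {..<n} = {x. poly ?P x = 0}"
    by (intro card_subset_eq fin sub) (use card_mono[OF fin sub] in linarith)
  moreover have "u \<in> {x. poly ?P x = 0}" using assms(2) by (simp add: poly_monom)
  ultimately show ?thesis by auto
qed

lemma sum_roots_of_unity:
  assumes "(u :: 'a::field) ^ n = 1"
  shows "(\<Sum>l<n. u ^ l) = (if u = 1 then of_nat n else 0)"
proof (cases "u = 1")
  case False
  have "(u - 1) * (\<Sum>l<n. u ^ l) = u ^ n - 1" by (simp add: power_diff_1_eq)
  with assms False show ?thesis by simp
qed simp

lemma prime_of_nat_nonzero:
  assumes "prime p" "p \<noteq> CHAR('a::field)"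
  shows "(of_nat p :: 'a) \<noteq> 0"
proof
  assume "(of_nat p :: 'a) = 0"
  then have "CHAR('a) dvd p" by (simp add: of_nat_eq_0_iff_char_dvd)
  with assms show False using CHAR_not_1'[where ?'a='a]
    by (metis One_nat_def prime_nat_iff)
qed

section \<open>Linear algebra\<close>

text \<open>An infinite-dimensional space has \<open>dim\<close> equal to \<open>0\<close>, so an upper bound on \<open>dim\<close> says little by
itself; upper bounds are phrased through independent subsets instead.\<close>

definition dim_le :: "('a::field \<Rightarrow> 'b::ab_group_add \<Rightarrow> 'b) \<Rightarrow> 'b set \<Rightarrow> nat \<Rightarrow> bool"
  where "dim_le scale S N \<longleftrightarrow>
    (\<forall>B. B \<subseteq> S \<and> finite B \<and> \<not> module.dependent scale B \<longrightarrow> card B \<le> N)"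

context vector_space begin

lemma dim_le_span:
  assumes "Y \<subseteq> span T" "finite T" "card T \<le> N"
  shows "dim_le scale Y N"
  unfolding dim_le_def using independent_span_bound[OF assms(2)] assms
  by (meson dual_order.trans)

lemma independent_familyI:
  assumes fin: "finite I"
    and ind: "\<And>c. (\<Sum>i\<in>I. scale (c i) (b i)) = 0 \<Longrightarrow> \<forall>i\<in>I. c i = 0"
  shows "inj_on b I" "independent (b ` I)"
proof -
  show inj: "inj_on b I"
  proof (rule inj_onI, rule ccontr)
    fix i j assume ij: "i \<in> I" "j \<in> I" "b i = b j" "i \<noteq> j"
    define c where "c k = (if k = i then 1 else if k = j then -1 else 0 :: 'a)" for k
    have "(\<Sum>k\<in>I. scale (c k) (b k)) = (\<Sum>k\<in>{i,j}. scale (c k) (b k))"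
      using fin ij by (intro sum.mono_neutral_right) (auto simp: c_def)
    also have "\<dots> = 0" using ij by (simp add: c_def)
    finally have "c i = 0" using ind ij by blast
    then show False by (simp add: c_def)
  qed
  show "independent (b ` I)"
  proof (rule independent_if_scalars_zero)
    fix f x assume s: "(\<Sum>x\<in>b ` I. scale (f x) x) = 0" and x: "x \<in> b ` I"
    have "(\<Sum>i\<in>I. scale (f (b i)) (b i)) = 0" using s inj by (simp add: sum.reindex)
    then have "\<forall>i\<in>I. f (b i) = 0" by (rule ind)
    with x show "f x = 0" by auto
  qed (use fin in simp)
qed

lemma independent_familyD:
  assumes "finite I" "inj_on b I" "independent (b ` I)" "(\<Sum>i\<in>I. scale (c i) (b i)) = 0" "i \<in> I"
  shows "c i = 0"
proof -
  have "(\<Sum>x\<in>b ` I. scale (c (the_inv_into I b x)) x) = 0"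
    using assms by (simp add: sum.reindex the_inv_into_f_f)
  from independentD[OF assms(3) _ _ this, of "b i"] assms show ?thesis
    by (simp add: the_inv_into_f_f)
qed

text \<open>The premises say that the sum of the images \<open>f t ` S\<close> is direct and that every \<open>f t\<close> is injective
on \<open>S\<close>; a basis of \<open>S\<close> then gives \<open>card T\<close> times as many independent vectors in \<open>Y\<close>.\<close>

lemma dim_le_direct_sum:
  assumes Y: "dim_le scale Y N" and S: "subspace S" and T: "finite T"
    and lin: "\<And>t. t \<in> T \<Longrightarrow> module_hom scale scale (f t)"
    and into: "\<And>t s. t \<in> T \<Longrightarrow> s \<in> S \<Longrightarrow> f t s \<in> Y"
    and dir: "\<And>g. \<lbrakk>\<And>t. t \<in> T \<Longrightarrow> g t \<in> S; (\<Sum>t\<in>T. f t (g t)) = 0\<rbrakk> \<Longrightarrow> \<forall>t\<in>T. g t = 0"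
    and N: "N < card T * Suc d"
  shows "dim_le scale S d"
  unfolding dim_le_def
proof (intro allI impI, elim conjE)
  fix B assume B: "B \<subseteq> S" "finite B" "independent B"
  let ?b = "\<lambda>(t,x). f t x"
  have zero: "\<forall>i\<in>T \<times> B. c i = 0" if c: "(\<Sum>i\<in>T \<times> B. scale (c i) (?b i)) = 0" for c
  proof -
    have "(\<Sum>t\<in>T. \<Sum>x\<in>B. scale (c (t,x)) (f t x)) = 0"
      using c by (simp add: sum.cartesian_product case_prod_unfold)
    also have "(\<Sum>t\<in>T. \<Sum>x\<in>B. scale (c (t,x)) (f t x)) = (\<Sum>t\<in>T. f t (\<Sum>x\<in>B. scale (c (t,x)) x))"
    proof (rule sum.cong[OF refl])
      fix t assume "t \<in> T"
      then interpret module_hom scale scale "f t"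
        using lin by simp
      show "(\<Sum>x\<in>B. scale (c (t,x)) (f t x)) = f t (\<Sum>x\<in>B. scale (c (t,x)) x)"
        by (simp add: sum scale)
    qed
    finally have 0: "(\<Sum>t\<in>T. f t (\<Sum>x\<in>B. scale (c (t,x)) x)) = 0" .
    have "(\<Sum>x\<in>B. scale (c (t,x)) x) \<in> S" for t
      using B(1) by (intro subspace_sum[OF S] subspace_scale[OF S]) auto
    with 0 have *: "\<forall>t\<in>T. (\<Sum>x\<in>B. scale (c (t,x)) x) = 0" by (intro dir)
    show ?thesis
    proof
      fix i assume i: "i \<in> T \<times> B"
      then have "(\<Sum>x\<in>B. scale (c (fst i,x)) x) = 0" using * by auto
      from independentD[OF B(3,2) subset_refl this, of "snd i"] i show "c i = 0" by auto
    qed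
  qed
  have fin: "finite (T \<times> B)" using T B by auto
  note * = independent_familyI[of "T \<times> B" ?b, OF fin zero]
  have "card (T \<times> B) = card (?b ` (T \<times> B))" by (rule card_image[symmetric, OF *(1)])
  also have "\<dots> \<le> N" 
  proof -
    have "?b ` (T \<times> B) \<subseteq> Y" using B(1) into by auto
    then show ?thesis using Y *(2) fin unfolding dim_le_def by blast
  qed
  finally have "card T * card B < card T * Suc d" using N by (simp add: card_cartesian_product)
  then show "card B \<le> d" by (simp del: mult_Suc_right)
qed

text \<open>Eigenvectors to distinct eigenvalues are independent, stated for sums that may contain zero
  vectors.\<close>

lemma eigenvectors_sum_zero:
  assumes "finite T" "module_hom scale scale f" "inj_on \<mu> T"
    and "\<And>t. t \<in> T \<Longrightarrow> f (w t) = scale (\<mu> t) (w t)" "(\<Sum>t\<in>T. w t) = 0"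
  shows "\<forall>t\<in>T. w t = 0"
  using assms
proof (induction T arbitrary: w rule: finite_induct)
  case (insert a T)
  interpret module_hom scale scale f by (rule insert.prems(1))
  have s: "w a + sum w T = 0" using insert by simp
  then have "f (w a) + f (sum w T) = 0" by (metis add zero)
  then have 1: "scale (\<mu> a) (w a) + (\<Sum>t\<in>T. scale (\<mu> t) (w t)) = 0"
    using insert.prems(3) by (simp add: sum)
  have 2: "scale (\<mu> a) (w a) + (\<Sum>t\<in>T. scale (\<mu> a) (w t)) = 0"
    using s by (metis scale_right_distrib scale_sum_right scale_zero_right)
  have 3: "(\<Sum>t\<in>T. scale (\<mu> t - \<mu> a) (w t)) = 0"
    using 1 2 by (simp add: scale_left_diff_distrib sum_subtractf) (metis add_left_cancel)
  have "\<forall>t\<in>T. scale (\<mu> t - \<mu> a) (w t) = 0"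
  proof (rule insert.IH[OF insert.prems(1)])
    show "inj_on \<mu> T" using insert.prems(2) by simp
    show "f (scale (\<mu> t - \<mu> a) (w t)) = scale (\<mu> t) (scale (\<mu> t - \<mu> a) (w t))" if "t \<in> T" for t
      using that insert.prems(3) by (simp add: scale mult.commute)
  qed (use 3 in simp)
  moreover have "\<mu> t \<noteq> \<mu> a" if "t \<in> T" for t
    using insert.prems(2) insert.hyps that by (auto simp: inj_on_def)
  ultimately have "\<forall>t\<in>T. w t = 0" by simp
  with s show ?case by simp
qed simp

end

section \<open>Operators whose p-th power is a scalar\<close>

lemma det_pow_mat:
  fixes N :: "'a::comm_ring_1 mat"
  assumes "N \<in> carrier_mat d d"
  shows "det (N ^\<^sub>m k) = det N ^ k"
  using assms by (induction k) (simp_all add: det_mult[of _ d] pow_carrier_mat mult.commute)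

lemma is_power_if_coprime_power_is_power:
  fixes v t :: "'a::field"
  assumes "coprime d p" "d > 0" "v \<noteq> 0" "t ^ p = v ^ d"
  shows "\<exists>u. u ^ p = v"
proof -
  obtain a b where ab: "d * a = p * b + 1" using bezout_nat[of d p] assms by auto
  have "(t ^ a / v ^ b) ^ p = (t ^ p) ^ a / v ^ (p * b)"
    by (simp add: power_divide power_mult[symmetric] mult.commute)
  also have "(t ^ p) ^ a = v ^ (p * b + 1)" using assms(4) ab by (simp add: power_mult[symmetric])
  finally have "(t ^ a / v ^ b) ^ p = v" using assms(3) by (simp add: power_add)
  then show ?thesis by blast
qed

context vector_space begin

lemma module_hom_funpow:
  assumes "module_hom scale scale f"
  shows "module_hom scale scale (f ^^ k)"
proof (induction k)
  case 0
  show ?case by unfold_locales auto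
next
  case (Suc k)
  interpret f: module_hom scale scale f by fact
  interpret fk: module_hom scale scale "f ^^ k" by fact
  show ?case by unfold_locales (auto simp: f.add f.scale fk.add fk.scale)
qed

text \<open>Taking determinants of \<open>J ^ p = v\<close> on a subspace of dimension \<open>d\<close> gives
  \<open>det J ^ p = v ^ d\<close>; if \<open>d\<close> were prime to \<open>p\<close>, then \<open>v\<close> itself would be a \<open>p\<close>-th power.  This
  replaces the irreducibility of \<open>t ^ p - v\<close>.\<close>

lemma prime_dvd_card_basis:
  assumes hom: "module_hom scale scale J" and B: "finite B" "independent B"
    and inv: "\<And>b. b \<in> B \<Longrightarrow> J b \<in> span B" and pow: "\<And>b. b \<in> B \<Longrightarrow> (J ^^ p) b = scale v b"
    and p: "prime p" and v: "v \<noteq> 0" "\<nexists>t. t ^ p = v"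
  shows "p dvd card B"
proof (rule ccontr)
  assume ndvd: "\<not> p dvd card B"
  obtain bs where bs: "set bs = B" "distinct bs" using finite_distinct_list[OF B(1)] by blast
  define d where "d = length bs"
  have card: "card B = d" using bs by (simp add: d_def distinct_card[symmetric])
  have bij: "bij_betw (\<lambda>i. bs ! i) {..<d} B"
    using bij_betw_nth[OF bs(2)] bs(1) by (simp add: d_def)
  then have inj: "inj_on (\<lambda>i. bs ! i) {..<d}" and img: "(\<lambda>i. bs ! i) ` {..<d} = B"
    by (auto simp: bij_betw_def)
  have mem: "bs ! i \<in> B" if "i < d" for i using that img by auto
  define N where "N = mat d d (\<lambda>(i,j). representation B (J (bs ! j)) (bs ! i))"
  have N: "N \<in> carrier_mat d d" by (simp add: N_def)
  then have Nk: "N ^\<^sub>m k \<in> carrier_mat d d" for k by (rule pow_carrier_mat)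
  have J1: "J (bs ! j) = (\<Sum>i<d. scale (N $$ (i,j)) (bs ! i))" if "j < d" for j
  proof -
    have "J (bs ! j) = (\<Sum>b\<in>B. scale (representation B (J (bs ! j)) b) b)"
      using sum_representation_eq[OF B(2) inv[OF mem[OF that]] B(1) order_refl] by simp
    also have "\<dots> = (\<Sum>i<d. scale (representation B (J (bs ! j)) (bs ! i)) (bs ! i))"
      by (rule sum.reindex_bij_betw[OF bij, symmetric])
    finally show ?thesis using that by (simp add: N_def)
  qed
  have Jk: "(J ^^ k) (bs ! j) = (\<Sum>i<d. scale ((N ^\<^sub>m k) $$ (i,j)) (bs ! i))" if "j < d" for j k
    using that
  proof (induction k arbitrary: j)
    case 0
    have "(\<Sum>i<d. scale ((1\<^sub>m d) $$ (i,j)) (bs ! i)) = (\<Sum>i<d. if i = j then bs ! i else 0)"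
      using 0 by (intro sum.cong) auto
    then show ?case using 0 N by simp
  next
    case (Suc k)
    interpret fk: module_hom scale scale "J ^^ k" by (rule module_hom_funpow[OF hom])
    have "(J ^^ Suc k) (bs ! j) = (J ^^ k) (J (bs ! j))" by (simp add: funpow_swap1)
    also have "\<dots> = (\<Sum>l<d. scale (N $$ (l,j)) (\<Sum>i<d. scale ((N ^\<^sub>m k) $$ (i,l)) (bs ! i)))"
      using Suc by (simp add: J1 fk.sum fk.scale)
    also have "\<dots> = (\<Sum>i<d. \<Sum>l<d. scale ((N ^\<^sub>m k) $$ (i,l) * N $$ (l,j)) (bs ! i))"
      by (subst sum.swap) (simp add: scale_sum_right mult.commute)
    also have "\<dots> = (\<Sum>i<d. scale ((N ^\<^sub>m Suc k) $$ (i,j)) (bs ! i))"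
      using Suc.prems N Nk[of k]
      by (intro sum.cong) (auto simp: scalar_prod_def scale_sum_left lessThan_atLeast0)
    finally show ?case .
  qed
  have "N ^\<^sub>m p = v \<cdot>\<^sub>m 1\<^sub>m d"
  proof (rule eq_matI)
    fix i j assume "i < dim_row (v \<cdot>\<^sub>m 1\<^sub>m d)" "j < dim_col (v \<cdot>\<^sub>m 1\<^sub>m d)"
    then have ij: "i < d" "j < d" by auto
    have "(\<Sum>i<d. scale ((N ^\<^sub>m p) $$ (i,j)) (bs ! i)) = scale v (bs ! j)"
      using Jk[OF ij(2)] pow[OF mem[OF ij(2)]] by simp
    also have "\<dots> = (\<Sum>i<d. scale (if i = j then v else 0) (bs ! i))"
      using ij by (simp add: if_distrib[of "\<lambda>c. scale c _"] cong: if_cong)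
    finally have "(\<Sum>i<d. scale ((N ^\<^sub>m p) $$ (i,j) - (if i = j then v else 0)) (bs ! i)) = 0"
      by (simp add: scale_left_diff_distrib sum_subtractf)
    from independent_familyD[OF _ inj _ this] B img ij
    have "(N ^\<^sub>m p) $$ (i,j) - (if i = j then v else 0) = 0" by auto
    then show "(N ^\<^sub>m p) $$ (i,j) = (v \<cdot>\<^sub>m 1\<^sub>m d) $$ (i,j)" using ij by simp
  qed (use Nk[of p] in auto)
  then have "det N ^ p = v ^ d" using det_pow_mat[OF N, of p] by simp
  moreover have "coprime d p" "d > 0"
    using ndvd card p by (auto simp: prime_imp_coprime coprime_commute intro!: Nat.gr0I)
  ultimately show False using is_power_if_coprime_power_is_power v by blast
qed

text \<open>The span of the orbit has dimension at most \<open>p\<close>, and a multiple of \<open>p\<close> by \<open>prime_dvd_card_basis\<close>.\<close>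

lemma orbit_independent:
  assumes hom: "module_hom scale scale J" and pow: "(J ^^ p) s = scale v s" and s: "s \<noteq> 0"
    and p: "prime p" and v: "v \<noteq> 0" "\<nexists>t. t ^ p = v"
  shows "inj_on (\<lambda>k. (J ^^ k) s) {..<p}" "independent ((\<lambda>k. (J ^^ k) s) ` {..<p})"
proof -
  let ?O = "(\<lambda>k. (J ^^ k) s) ` {..<p}"
  have p0: "p > 0" using p by (simp add: prime_gt_0_nat)
  obtain B where B: "B \<subseteq> ?O" "independent B" "?O \<subseteq> span B"
    using maximal_independent_subset[of ?O] by blast
  have finB: "finite B" using B(1) by (rule finite_subset) simp
  have sB: "s \<in> span B" using B(3) p0 by (auto intro!: subsetD[OF B(3)] image_eqI[of _ _ 0])
  have "p dvd card B"
  proof (rule prime_dvd_card_basis[OF hom finB B(2) _ _ p v])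
    fix b assume "b \<in> B"
    with B(1) obtain k where k: "k < p" "b = (J ^^ k) s" by auto
    have Jb: "J b = (J ^^ Suc k) s" using k by simp
    show "J b \<in> span B"
    proof (cases "Suc k < p")
      case True
      with Jb have "J b \<in> ?O" by blast
      then show ?thesis using B(3) by blast
    next
      case False
      with k have "Suc k = p" by simp
      with Jb pow sB show ?thesis by (simp add: span_scale)
    qed
    interpret fk: module_hom scale scale "J ^^ k" by (rule module_hom_funpow[OF hom])
    have "(J ^^ p) b = (J ^^ k) ((J ^^ p) s)"
      by (simp add: k(2) add.commute flip: funpow_add[THEN fun_cong, unfolded comp_def])
    then show "(J ^^ p) b = scale v b" by (simp add: pow fk.scale k(2))
  qed
  moreover have "card B > 0" using sB s finB by (auto simp: card_gt_0_iff)
  ultimately have "p \<le> card B" by (rule dvd_imp_le)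
  moreover have "card B \<le> card ?O" by (rule card_mono[OF _ B(1)]) simp
  moreover have "card ?O \<le> p" using card_image_le[of "{..<p}" "\<lambda>k. (J ^^ k) s"] by simp
  ultimately have c: "card ?O = p" "card B = card ?O" by linarith+
  show "inj_on (\<lambda>k. (J ^^ k) s) {..<p}" using c(1) by (intro eq_card_imp_inj_on) auto
  have "B = ?O" using c(2) B(1) by (intro card_subset_eq) auto
  then show "independent ?O" using B(2) by simp
qed

lemma independent_span_eq:
  assumes B: "finite B" "independent B" "B \<subseteq> V" and V: "dim_le scale V N" "subspace V" "N \<le> card B"
  shows "span B = V"
proof
  show "span B \<subseteq> V" using B V by (simp add: span_minimal)
  show "V \<subseteq> span B"
  proof (rule ccontr)
    assume "\<not> V \<subseteq> span B"
    then obtain x where x: "x \<in> V" "x \<notin> span B" by blast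
    then have "independent (insert x B)" using B by (simp add: independent_insertI)
    then have "card (insert x B) \<le> N" using V(1) B x unfolding dim_le_def by auto
    moreover have "x \<notin> B" using x(2) span_base by blast
    ultimately show False using V(3) B(1) by simp
  qed
qed

end

section \<open>Polynomials in an operator\<close>

text \<open>This is \<open>q(J) s\<close>, evaluated by Horner's rule.\<close>

definition poly_act ::
    "('a::field \<Rightarrow> 'b::ab_group_add \<Rightarrow> 'b) \<Rightarrow> ('b \<Rightarrow> 'b) \<Rightarrow> 'b \<Rightarrow> 'a poly \<Rightarrow> 'b"
  where "poly_act scale J s q = fold_coeffs (\<lambda>a t. scale a s + J t) q 0"

locale cyclic_operator = vector_space scale + J: module_hom scale scale J
  for scale :: "'a::field \<Rightarrow> 'b::ab_group_add \<Rightarrow> 'b" and J :: "'b \<Rightarrow> 'b" +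
  fixes s :: 'b
begin

abbreviation act where "act \<equiv> poly_act scale J s"

lemma act_0 [simp]: "act 0 = 0"
  by (simp add: poly_act_def)

lemma act_pCons [simp]: "act (pCons a q) = scale a s + J (act q)"
  by (cases "a = 0 \<and> q = 0") (auto simp: poly_act_def J.zero)

lemma act_1: "act 1 = s"
  by (simp add: one_pCons J.zero)

lemma act_add: "act (q + r) = act q + act r"
  by (induction q r rule: poly_induct2) (simp_all add: J.add scale_left_distrib algebra_simps)

lemma act_smult: "act (smult c q) = scale c (act q)"
  by (induction q) (simp_all add: J.scale scale_right_distrib)

lemma act_diff: "act (q - r) = act q - act r"
  using act_add[of "q - r" r] by (simp add: algebra_simps)

lemma act_monom_mult: "act (monom 1 n * q) = (J ^^ n) (act q)"
  by (induction n) (simp_all add: monom_Suc)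

lemma act_sum: "act (sum f A) = (\<Sum>i\<in>A. act (f i))"
  by (induction A rule: infinite_finite_induct) (simp_all add: act_add)

lemma act_monom: "act (monom c n) = scale c ((J ^^ n) s)"
  using act_smult[of c "monom 1 n"] act_monom_mult[of n 1] by (simp add: smult_monom act_1)

lemma act_degree_less:
  assumes "degree q < n"
  shows "act q = (\<Sum>i<n. scale (coeff q i) ((J ^^ i) s))"
proof -
  have "q = (\<Sum>i<n. monom (coeff q i) i)"
    by (rule poly_eqI) (use assms in \<open>auto simp: coeff_sum coeff_eq_0\<close>)
  then have "act q = act (\<Sum>i<n. monom (coeff q i) i)" by simp
  then show ?thesis by (simp add: act_sum act_monom)
qed

lemma span_orbit: "span ((\<lambda>k. (J ^^ k) s) ` {..<n}) \<subseteq> range act"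
proof (rule span_minimal)
  show "(\<lambda>k. (J ^^ k) s) ` {..<n} \<subseteq> range act"
    using act_monom[of 1] by (metis image_subsetI rangeI scale_one)
  show "subspace (range act)"
    unfolding subspace_def
  proof (intro conjI ballI allI)
    show "0 \<in> range act" using act_0 by (metis rangeI)
    show "x + y \<in> range act" if "x \<in> range act" "y \<in> range act" for x y
      using that by (auto simp flip: act_add)
    show "scale c x \<in> range act" if "x \<in> range act" for c x
      using that by (auto simp flip: act_smult)
  qed
qed

text \<open>Division by \<open>t ^ n - v\<close> leaves a remainder of degree less than \<open>n\<close> that still annihilates \<open>s\<close>, and
independence of the orbit makes its coefficients vanish.\<close>

lemma act_eq_0_imp_dvd:
  assumes pow: "(J ^^ n) s = scale v s" and n: "n > 0"
    and ind: "inj_on (\<lambda>k. (J ^^ k) s) {..<n}" "independent ((\<lambda>k. (J ^^ k) s) ` {..<n})"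
    and q: "act q = 0"
  shows "monom 1 n - [:v:] dvd q"
proof -
  let ?P = "monom 1 n - [:v:]"
  interpret Jn: module_hom scale scale "J ^^ n"
    by (rule module_hom_funpow) (rule J.module_hom_axioms)
  have "(J ^^ n) (act r) = scale v (act r)" for r
    by (induction r)
      (simp_all add: pow Jn.zero Jn.add Jn.scale J.scale funpow_swap1[symmetric] scale_right_distrib mult.commute)
  then have P0: "act (?P * r) = 0" for r
    by (simp add: left_diff_distrib act_diff act_monom_mult act_smult)
  have cn: "coeff ?P n = 1" using n by (cases n) simp_all
  have degP: "degree ?P = n"
  proof (rule antisym)
    show "degree ?P \<le> n" by (rule degree_diff_le) (auto simp: degree_monom_le)
    show "n \<le> degree ?P" by (rule le_degree) (metis cn zero_neq_one)
  qed
  have Pnz: "?P \<noteq> 0" using cn by (metis coeff_0 zero_neq_one)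
  have deg: "q mod ?P = 0 \<or> degree (q mod ?P) < n" using degree_mod_less[OF Pnz, of q] degP by simp
  have "act (q mod ?P) = act q"
    using act_add[of "?P * (q div ?P)" "q mod ?P"] P0[of "q div ?P"] by simp
  then have a0: "act (q mod ?P) = 0" using q by simp
  have "q mod ?P = 0"
  proof (rule ccontr)
    assume nz: "q mod ?P \<noteq> 0"
    with deg have d: "degree (q mod ?P) < n" by simp
    have "(\<Sum>i<n. scale (coeff (q mod ?P) i) ((J ^^ i) s)) = 0"
      using a0 act_degree_less[OF d] by simp
    from independent_familyD[OF _ ind this] have "coeff (q mod ?P) (degree (q mod ?P)) = 0"
      using d by simp
    with nz show False by simp
  qed
  then show ?thesis by (simp add: dvd_eq_mod_eq_0)
qed

end

section \<open>Norms from radical extensions\<close>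

interpretation to_ac: inj_comm_ring_hom "to_ac :: 'a::field \<Rightarrow> 'a alg_closure"
  by unfold_locales auto

definition ac_eval :: "'a::field alg_closure \<Rightarrow> 'a poly \<Rightarrow> 'a alg_closure"
  where "ac_eval z q = poly (map_poly to_ac q) z"

lemma ac_eval_pCons [simp]: "ac_eval z (pCons a q) = to_ac a + z * ac_eval z q"
  by (simp add: ac_eval_def map_poly_pCons)

lemma ac_eval_0 [simp]: "ac_eval z 0 = 0"
  by (simp add: ac_eval_def)

lemma ac_eval_add: "ac_eval z (q + r) = ac_eval z q + ac_eval z r"
  by (induction q r rule: poly_induct2) (simp_all add: algebra_simps)

lemma ac_eval_smult: "ac_eval z (smult c q) = to_ac c * ac_eval z q"
  by (induction q) (simp_all add: algebra_simps)

lemma ac_eval_diff: "ac_eval z (q - r) = ac_eval z q - ac_eval z r"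
  using ac_eval_add[of z "q - r" r] by simp

lemma ac_eval_mult: "ac_eval z (q * r) = ac_eval z q * ac_eval z r"
  by (induction q) (simp_all add: ac_eval_add ac_eval_smult algebra_simps)

lemma ac_eval_1 [simp]: "ac_eval z 1 = 1"
  by (simp add: one_pCons)

lemma ac_eval_sum: "ac_eval z (sum f A) = (\<Sum>i\<in>A. ac_eval z (f i))"
  by (induction A rule: infinite_finite_induct) (simp_all add: ac_eval_add)

lemma ac_eval_prod: "ac_eval z (prod f A) = (\<Prod>i\<in>A. ac_eval z (f i))"
  by (induction A rule: infinite_finite_induct) (simp_all add: ac_eval_mult)

lemma ac_eval_monom: "ac_eval z (monom c n) = to_ac c * z ^ n"
  by (induction n) (simp_all add: monom_0 monom_Suc)

lemma ac_eval_pcompose: "ac_eval z (q \<circ>\<^sub>p [:0, c:]) = ac_eval (to_ac c * z) q"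
  by (induction q) (simp_all add: pcompose_pCons ac_eval_add ac_eval_mult ac_eval_smult algebra_simps)

lemma ac_module_hom_mult: "module_hom ac_scale ac_scale ((*) r)"
  by unfold_locales (simp_all add: algebra_simps ac_scale_def)

lemma funpow_mult_one: "((*) r ^^ k) (1 :: 'a::comm_monoid_mult) = r ^ k"
  by (induction k) simp_all

lemma ac_cyclic_operator:
  "cyclic_operator ac_scale ((*) r)"
  by (simp add: cyclic_operator_def ac.vector_space_axioms ac_module_hom_mult)

lemma poly_act_ac: "poly_act ac_scale ((*) r) 1 q = ac_eval r q"
proof -
  interpret cyclic_operator ac_scale "(*) r" 1 by (rule ac_cyclic_operator)
  show ?thesis by (induction q) (simp, simp only: act_pCons ac_eval_pCons, simp add: ac_scale_def)
qed

lemma field_ring_simps: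
  "x \<oplus>\<^bsub>field_ring\<^esub> y = x + y" "x \<otimes>\<^bsub>field_ring\<^esub> y = x * y"
  "\<zero>\<^bsub>field_ring\<^esub> = 0" "\<one>\<^bsub>field_ring\<^esub> = 1" "carrier field_ring = UNIV"
  by (simp_all add: ring_of_type_algebra_def)

lemma generate_field_subset:
  fixes S :: "'a::field set"
  assumes H: "H \<subseteq> S" and one: "1 \<in> S"
    and add: "\<And>x y. x \<in> S \<Longrightarrow> y \<in> S \<Longrightarrow> x + y \<in> S" and mult: "\<And>x y. x \<in> S \<Longrightarrow> y \<in> S \<Longrightarrow> x * y \<in> S"
    and neg: "\<And>x. x \<in> S \<Longrightarrow> - x \<in> S" and inv: "\<And>x. x \<in> S \<Longrightarrow> x \<noteq> 0 \<Longrightarrow> inverse x \<in> S"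
  shows "generate_field field_ring H \<subseteq> S"
proof
  interpret K: Ring.field "field_ring :: 'a ring" by (rule field_from_type_algebra)
  have neg_eq: "\<ominus>\<^bsub>field_ring\<^esub> x = - x" for x :: 'a
    using K.minus_equality[of "- x" x] by (simp add: field_ring_simps)
  have inv_eq: "inv\<^bsub>field_ring\<^esub> x = inverse x" if "x \<noteq> 0" for x :: 'a
    using K.inv_unique'[of x "inverse x"] that by (simp add: field_ring_simps)
  fix x assume "x \<in> generate_field field_ring H"
  then show "x \<in> S"
    by induction (use assms in \<open>auto simp: field_ring_simps neg_eq inv_eq\<close>)
qed

lemma primitive_root_to_ac:
  "primitive_root_of_unity n (to_ac z) \<longleftrightarrow> primitive_root_of_unity n z"
  by (simp add: primitive_root_of_unity_def flip: to_ac_power to_ac_1 del: to_ac_1 to_ac_power)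

lemma nth_root_in_alg_closure: "\<exists>r :: 'a::field alg_closure. r ^ n = to_ac b" if "n > 0"
  using nth_root_exists[OF that] by blast

locale radical_extension =
  fixes p :: nat and \<zeta> v :: "'a::field" and r :: "'a alg_closure"
  assumes p: "prime p" and charp: "p \<noteq> CHAR('a)" and zeta: "primitive_root_of_unity p \<zeta>"
    and v: "v \<noteq> 0" "\<nexists>t. t ^ p = v" and r: "r ^ p = to_ac v"
begin

lemma p_pos: "p > 0" using p by (simp add: prime_gt_0_nat)

lemma r_nonzero: "r \<noteq> 0"
  using r v p_pos by (metis power_0_left to_ac_eq_0_iff not_gr_zero)

lemma powers_independent:
  "inj_on (\<lambda>k. r ^ k) {..<p}" "\<not> ac_dependent ((\<lambda>k. r ^ k) ` {..<p})"
  using ac.orbit_independent[OF ac_module_hom_mult _ _ p v, of r 1] r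
  by (simp_all add: funpow_mult_one ac_scale_def)

lemma eval_eq_0_imp_dvd:
  assumes "ac_eval r q = 0"
  shows "monom 1 p - [:v:] dvd q"
proof -
  interpret cyclic_operator ac_scale "(*) r" 1 by (rule ac_cyclic_operator)
  show ?thesis
    by (rule act_eq_0_imp_dvd[OF _ p_pos])
      (use assms powers_independent r in \<open>simp_all add: funpow_mult_one poly_act_ac ac_scale_def flip: ac_dependent_def\<close>)
qed

text \<open>The root \<open>r\<close> may be replaced by any of its conjugates; this stands in for the embeddings of
\<open>F(r)\<close> into the algebraic closure.\<close>

lemma eval_conjugate_eq_0:
  assumes "ac_eval r q = 0" "z ^ p = to_ac v"
  shows "ac_eval z q = 0"
proof -
  obtain q' where "q = (monom 1 p - [:v:]) * q'" using eval_eq_0_imp_dvd[OF assms(1)] by (rule dvdE)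
  then show ?thesis using assms(2) by (simp add: ac_eval_mult ac_eval_diff ac_eval_monom)
qed

lemma eval_conjugate_eq:
  assumes "ac_eval r q = ac_eval r q'" "z ^ p = to_ac v"
  shows "ac_eval z q = ac_eval z q'"
  using eval_conjugate_eq_0[of "q - q'"] assms by (simp add: ac_eval_diff)

lemma range_eval_eq_span: "range (ac_eval r) = ac_span ((\<lambda>k. r ^ k) ` {..<p})"
proof
  interpret cyclic_operator ac_scale "(*) r" 1 by (rule ac_cyclic_operator)
  show "ac_span ((\<lambda>k. r ^ k) ` {..<p}) \<subseteq> range (ac_eval r)"
    using span_orbit[of p] by (simp add: funpow_mult_one poly_act_ac[abs_def] flip: ac_span_def)
  have "ac_eval r q \<in> ac_span ((\<lambda>k. r ^ k) ` {..<p})" for q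
  proof -
    have "r ^ i \<in> ac_span ((\<lambda>k. r ^ k) ` {..<p})" for i
    proof -
      have "r ^ i = r ^ (p * (i div p) + i mod p)" by simp
      also have "\<dots> = ac_scale (v ^ (i div p)) (r ^ (i mod p))"
        by (simp only: power_add power_mult r ac_scale_def to_ac_power)
      also have "\<dots> \<in> ac_span ((\<lambda>k. r ^ k) ` {..<p})"
        by (intro ac.span_scale ac.span_base) (use p_pos in auto)
      finally show ?thesis .
    qed
    from this have "(\<Sum>i\<le>degree q. ac_scale (coeff q i) (r ^ i)) \<in> ac_span ((\<lambda>k. r ^ k) ` {..<p})"
      by (intro ac.span_sum ac.span_scale)
    also have "(\<Sum>i\<le>degree q. ac_scale (coeff q i) (r ^ i)) = ac_eval r q"
      using ac_eval_sum[of r "\<lambda>i. monom (coeff q i) i" "{..degree q}"]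
      by (simp add: ac_eval_monom ac_scale_def poly_as_sum_of_monoms)
    finally show ?thesis .
  qed
  then show "range (ac_eval r) \<subseteq> ac_span ((\<lambda>k. r ^ k) ` {..<p})" by auto
qed

text \<open>Multiplication by \<open>z\<close> maps the basis of powers of \<open>r\<close> to \<open>p\<close> independent vectors, which again span,
so that \<open>1\<close> is a multiple of \<open>z\<close>.\<close>

lemma range_eval_inverse:
  assumes "z \<in> range (ac_eval r)" "z \<noteq> 0"
  shows "inverse z \<in> range (ac_eval r)"
proof -
  let ?E = "range (ac_eval r)"
  obtain q where q: "z = ac_eval r q" using assms by blast
  have inj: "inj_on ((*) z) (ac_span ((\<lambda>k. r ^ k) ` {..<p}))" using assms(2) by (auto simp: inj_on_def)
  interpret z: module_hom ac_scale ac_scale "(*) z" by (rule ac_module_hom_mult)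
  let ?B = "(*) z ` ((\<lambda>k. r ^ k) ` {..<p})"
  have "ac_span ?B = ?E"
  proof (rule ac.independent_span_eq)
    show "\<not> ac_dependent ?B"
      using z.independent_injective_image[folded ac_span_def ac_dependent_def, OF _ inj] powers_independent(2) by simp
    show "?B \<subseteq> ?E"
    proof clarify
      fix k
      have "z * r ^ k = ac_eval r (q * monom 1 k)" by (simp add: q ac_eval_mult ac_eval_monom)
      then show "z * r ^ k \<in> ?E" by blast
    qed
    show "dim_le ac_scale ?E p"
      unfolding range_eval_eq_span
      by (rule ac.dim_le_span[OF order_refl]) (use card_image_le[of "{..<p}"] in auto)
    show "ac.subspace ?E" by (simp add: range_eval_eq_span ac.subspace_span)
    show "p \<le> card ?B"
      using powers_independent(1) assms(2) by (simp add: card_image inj_on_def)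
  qed simp
  moreover have "1 \<in> ?E" using ac_eval_1 by (metis rangeI)
  ultimately have "1 \<in> (*) z ` ac_span ((\<lambda>k. r ^ k) ` {..<p})" by (simp add: z.span_image[folded ac_span_def])
  then have "1 \<in> (*) z ` ?E" by (simp add: range_eval_eq_span)
  then obtain y where "y \<in> ?E" "z * y = 1" by (metis imageE)
  then show ?thesis using inverse_unique[of z y] by simp
qed

end

lemma extension_basis_exists:
  assumes "finite B" "\<not> ac_dependent B" "ac_span B = E"
  shows "extension_basis E (SOME bs. extension_basis E bs)"
proof -
  obtain bs where "set bs = B" "distinct bs" using finite_distinct_list[OF assms(1)] by blast
  then have "extension_basis E bs" using assms by (simp add: extension_basis_def)
  then show ?thesis by (rule someI)
qed

lemma extension_basis_length:
  assumes "extension_basis E bs" "\<not> ac_dependent B" "ac_span B = E"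
  shows "length bs = card B"
proof -
  have "ac.dim E = card (set bs)" "ac.dim E = card B"
    using assms unfolding extension_basis_def by (metis ac.dim_span_eq_card_independent)+
  then show ?thesis using assms(1) by (simp add: extension_basis_def distinct_card)
qed

lemma extension_basis_expand:
  assumes bs: "extension_basis E bs" and z: "z \<in> E"
  shows "z = (\<Sum>i<length bs. to_ac (ac_representation (set bs) z (bs ! i)) * bs ! i)"
proof -
  have "z = (\<Sum>b\<in>set bs. ac_scale (ac_representation (set bs) z b) b)"
    using ac.sum_representation_eq[of "set bs" z "set bs"] bs z by (simp add: extension_basis_def)
  also have "\<dots> = (\<Sum>i<length bs. ac_scale (ac_representation (set bs) z (bs ! i)) (bs ! i))"
    using bij_betw_nth[of bs] bs
    by (intro sum.reindex_bij_betw[symmetric]) (auto simp: extension_basis_def)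
  finally show ?thesis by (simp only: ac_scale_def)
qed

context radical_extension begin

lemma generate_field_eq: "generate_field field_ring (insert r (range to_ac)) = range (ac_eval r)"
proof
  show "generate_field field_ring (insert r (range to_ac)) \<subseteq> range (ac_eval r)"
  proof (rule generate_field_subset)
    have "ac_eval r [:0, 1:] = r" "\<And>c. ac_eval r [:c:] = to_ac c" by simp_all
    then show "insert r (range to_ac) \<subseteq> range (ac_eval r)" by (metis image_subset_iff insert_subset rangeI)
    show "1 \<in> range (ac_eval r)" using ac_eval_1 by (metis rangeI)
    show "- x \<in> range (ac_eval r)" if "x \<in> range (ac_eval r)" for x
      using that by clarify (metis ac_eval_0 ac_eval_diff diff_0 rangeI)
    show "inverse x \<in> range (ac_eval r)" if "x \<in> range (ac_eval r)" "x \<noteq> 0" for x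
      using that by (rule range_eval_inverse)
  qed (auto simp flip: ac_eval_add ac_eval_mult)
  show "range (ac_eval r) \<subseteq> generate_field field_ring (insert r (range to_ac))" (is "_ \<subseteq> ?G")
  proof clarify
    fix q show "ac_eval r q \<in> ?G"
    proof (induction q)
      case 0
      have "to_ac 0 \<in> ?G" by (rule generate_field.incl) blast
      then show ?case by simp
    next
      case (pCons a q)
      have "to_ac a \<in> ?G" "r \<in> ?G" by (auto intro: generate_field.incl)
      then show ?case
        using generate_field.eng_add[of _ field_ring] generate_field.eng_mult[of _ field_ring] pCons.IH
        by (fastforce simp: field_ring_simps)
    qed
  qed
qed

definition conj_root :: "nat \<Rightarrow> 'a alg_closure"
  where "conj_root k = to_ac \<zeta> ^ k * r"

lemma conj_root_power: "conj_root k ^ p = to_ac v"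
proof -
  have "(\<zeta> ^ k) ^ p = 1"
    using zeta by (metis mult.commute power_mult power_one primitive_root_of_unity_def)
  then show ?thesis using r by (simp add: conj_root_def power_mult_distrib flip: to_ac_power)
qed

lemma conj_root_orthogonal:
  assumes "k < p" "l < p"
  shows "(\<Sum>i<p. conj_root k ^ i * inverse (conj_root l) ^ i) = (if k = l then of_nat p else 0)"
proof -
  let ?u = "conj_root k * inverse (conj_root l)"
  have nz: "conj_root l \<noteq> 0"
    using primitive_root_nonzero[OF zeta] r_nonzero by (simp add: conj_root_def)
  have z: "inj_on (\<lambda>k. to_ac \<zeta> ^ k) {..<p}"
    using primitive_root_inj[of p "to_ac \<zeta>"] zeta by (simp add: primitive_root_to_ac)
  have "?u ^ p = 1"
    using nz v by (simp add: power_mult_distrib power_inverse conj_root_power)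
  then have "(\<Sum>i<p. ?u ^ i) = (if ?u = 1 then of_nat p else 0)" by (rule sum_roots_of_unity)
  moreover have "?u = 1 \<longleftrightarrow> conj_root k = conj_root l"
    using nz by (auto simp: field_simps)
  moreover have "conj_root k = conj_root l \<longleftrightarrow> k = l"
    using assms z r_nonzero by (auto simp: conj_root_def inj_on_def)
  ultimately show ?thesis by (simp add: power_mult_distrib)
qed

text \<open>Let \<open>b\<^sub>1, \<dots>, b\<^sub>p\<close> be the basis chosen in the definition of the norm, \<open>M\<close> the matrix of multiplication by
\<open>q(r)\<close>, and \<open>P\<close> the matrix of the conjugates of the \<open>b\<^sub>j\<close>.  Conjugating the equations that define \<open>M\<close>
gives \<open>P M = D P\<close>, where \<open>D\<close> is diagonal with the conjugates of \<open>q(r)\<close> as entries.  For the basis of powers of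
\<open>r\<close>, \<open>P\<close> is the Vandermonde matrix \<open>V\<close>, whose columns are orthogonal in the sense of \<open>V W = p\<close>;
since \<open>V = P C\<close> for a change of basis \<open>C\<close>, \<open>P\<close> is invertible for every basis.\<close>

lemma field_norm_eval:
  "to_ac (field_norm (range (ac_eval r)) (ac_eval r q)) = (\<Prod>k<p. ac_eval (conj_root k) q)"
proof -
  let ?E = "range (ac_eval r)"
  define bs where "bs = (SOME bs. extension_basis ?E bs)"
  have B: "finite ((\<lambda>k. r ^ k) ` {..<p})" "\<not> ac_dependent ((\<lambda>k. r ^ k) ` {..<p})"
    "ac_span ((\<lambda>k. r ^ k) ` {..<p}) = ?E"
    using powers_independent by (simp_all add: range_eval_eq_span)
  have bs: "extension_basis ?E bs" unfolding bs_def by (rule extension_basis_exists[OF B])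
  have len: "length bs = p"
    using extension_basis_length[OF bs B(2,3)] powers_independent(1) by (simp add: card_image)
  have "bs ! i \<in> ?E" if "i < p" for i
    using bs that len ac.span_base[of "bs ! i" "set bs"] by (auto simp: extension_basis_def)
  then have "\<forall>i. \<exists>b. i < p \<longrightarrow> bs ! i = ac_eval r b" by (metis imageE)
  then obtain b where b: "\<And>i. i < p \<Longrightarrow> bs ! i = ac_eval r (b i)" by metis
  define M where "M = mat p p (\<lambda>(i,j). ac_representation (set bs) (ac_eval r q * bs ! j) (bs ! i))"
  define P where "P = mat p p (\<lambda>(k,j). ac_eval (conj_root k) (b j))"
  define D where "D = mat p p (\<lambda>(k,j). if k = j then ac_eval (conj_root k) q else 0)"
  define V where "V = mat p p (\<lambda>(k,i). conj_root k ^ i)"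
  define W where "W = mat p p (\<lambda>(i,l). inverse (conj_root l) ^ i)"
  define C where "C = mat p p (\<lambda>(j,i). ac_representation (set bs) (r ^ i) (bs ! j))"
  note defs = M_def P_def D_def V_def W_def C_def
  have carr [simp]: "M \<in> carrier_mat p p" "P \<in> carrier_mat p p" "D \<in> carrier_mat p p"
    "V \<in> carrier_mat p p" "W \<in> carrier_mat p p" "C \<in> carrier_mat p p"
    "map_mat to_ac M \<in> carrier_mat p p" "map_mat to_ac C \<in> carrier_mat p p"
    by (simp_all add: defs)
  \<comment> \<open>Coordinates are in the base field, so an expansion in the basis survives conjugation.\<close>
  have conj_expand: "ac_eval (conj_root k) t
      = (\<Sum>i<p. to_ac (ac_representation (set bs) (ac_eval r t) (bs ! i)) * ac_eval (conj_root k) (b i))"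
    for k t
  proof -
    let ?c = "\<lambda>i. ac_representation (set bs) (ac_eval r t) (bs ! i)"
    have "ac_eval r t = (\<Sum>i<p. to_ac (?c i) * bs ! i)"
      using extension_basis_expand[OF bs, of "ac_eval r t"] by (simp add: len)
    also have "\<dots> = ac_eval r (\<Sum>i<p. smult (?c i) (b i))"
      by (simp add: ac_eval_sum ac_eval_smult b)
    finally have "ac_eval (conj_root k) t = ac_eval (conj_root k) (\<Sum>i<p. smult (?c i) (b i))"
      by (rule eval_conjugate_eq) (rule conj_root_power)
    then show ?thesis by (simp add: ac_eval_sum ac_eval_smult)
  qed
  have PM: "P * map_mat to_ac M = D * P"
  proof (rule eq_matI)
    fix k j assume "k < dim_row (D * P)" "j < dim_col (D * P)"
    then have kj: "k < p" "j < p" by (auto simp: defs)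
    have "(P * map_mat to_ac M) $$ (k,j)
        = (\<Sum>i<p. ac_eval (conj_root k) (b i) * to_ac (ac_representation (set bs) (ac_eval r q * bs ! j) (bs ! i)))"
      using kj by (simp add: defs scalar_prod_def lessThan_atLeast0)
    also have "\<dots> = ac_eval (conj_root k) (q * b j)"
      using kj by (subst conj_expand) (simp add: ac_eval_mult b mult.commute)
    also have "\<dots> = (\<Sum>i<p. if i = k then ac_eval (conj_root k) q * ac_eval (conj_root k) (b j) else 0)"
      using kj by (simp add: ac_eval_mult)
    also have "\<dots> = (D * P) $$ (k,j)"
      using kj by (simp add: defs scalar_prod_def lessThan_atLeast0 if_distrib[of "\<lambda>c. c * _"] cong: if_cong)
    finally show "(P * map_mat to_ac M) $$ (k,j) = (D * P) $$ (k,j)" .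
  qed (auto simp: defs)
  have VPC: "V = P * map_mat to_ac C"
  proof (rule eq_matI)
    fix k j assume "k < dim_row (P * map_mat to_ac C)" "j < dim_col (P * map_mat to_ac C)"
    then have kj: "k < p" "j < p" by (auto simp: defs)
    have "V $$ (k,j) = ac_eval (conj_root k) (monom 1 j)"
      using kj by (simp add: defs ac_eval_monom)
    also have "\<dots> = (P * map_mat to_ac C) $$ (k,j)"
      using kj by (subst conj_expand)
        (simp add: defs scalar_prod_def lessThan_atLeast0 ac_eval_monom mult.commute)
    finally show "V $$ (k,j) = (P * map_mat to_ac C) $$ (k,j)" .
  qed (auto simp: defs)
  have "V * W = of_nat p \<cdot>\<^sub>m 1\<^sub>m p"
  proof (rule eq_matI)
    fix k j assume "k < dim_row (of_nat p \<cdot>\<^sub>m 1\<^sub>m p :: 'a alg_closure mat)"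
      "j < dim_col (of_nat p \<cdot>\<^sub>m 1\<^sub>m p :: 'a alg_closure mat)"
    then have kj: "k < p" "j < p" by auto
    then show "(V * W) $$ (k,j) = (of_nat p \<cdot>\<^sub>m 1\<^sub>m p) $$ (k,j)"
      using conj_root_orthogonal[OF kj] by (simp add: defs scalar_prod_def lessThan_atLeast0)
  qed (auto simp: defs)
  then have "det V * det W = of_nat p ^ p" using det_mult[of V p W] by simp
  moreover have "(of_nat p :: 'a alg_closure) \<noteq> 0"
    using prime_of_nat_nonzero[OF p, where 'a="'a alg_closure"] charp by simp
  ultimately have "det V \<noteq> 0" by auto
  then have detP: "det P \<noteq> 0" using VPC det_mult[of P p "map_mat to_ac C"] by auto
  have "det P * det (map_mat to_ac M) = det D * det P"
    using PM carr by (metis det_mult)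
  then have "det (map_mat to_ac M) = det D" using detP by (metis mult.commute mult_left_cancel)
  also have "det D = (\<Prod>k<p. ac_eval (conj_root k) q)"
  proof -
    have "det D = prod_list (diag_mat D)"
      by (rule det_upper_triangular[of _ p]) (auto simp: defs)
    then show ?thesis by (simp add: prod_list_diag_prod) (simp add: defs lessThan_atLeast0)
  qed
  finally have "to_ac (det M) = (\<Prod>k<p. ac_eval (conj_root k) q)"
    by (simp add: to_ac.hom_det)
  moreover have "field_norm ?E (ac_eval r q) = det M"
    by (simp add: field_norm_def Let_def M_def bs_def[symmetric] len)
  ultimately show ?thesis by simp
qed

end

text \<open>A norm is recognised without mentioning the extension: it is enough that the product of the
twists of \<open>q\<close> is congruent to \<open>w\<close> modulo \<open>t ^ p - v\<close>, an identity that can be checked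
on any cyclic vector of an operator with \<open>J ^ p = v\<close>.\<close>

lemma radical_extension_norm_groupI:
  fixes q :: "'a::field poly"
  assumes p: "prime p" "p \<noteq> CHAR('a)" "primitive_root_of_unity p \<zeta>"
    and v: "v \<noteq> 0" "\<nexists>t. t ^ p = v" and w: "w \<noteq> 0"
    and dvd: "monom 1 p - [:v:] dvd (\<Prod>k<p. q \<circ>\<^sub>p [:0, \<zeta> ^ k:]) - [:w:]"
  shows "w \<in> norm_group (root_extension p v)"
proof -
  define r where "r = (SOME r. r ^ p = to_ac v)"
  have r: "r ^ p = to_ac v"
    unfolding r_def by (rule someI_ex, rule nth_root_in_alg_closure) (use p in \<open>simp add: prime_gt_0_nat\<close>)
  interpret radical_extension p \<zeta> v r using p v r by unfold_locales
  have E: "root_extension p v = range (ac_eval r)"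
    by (simp add: root_extension_def r_def[symmetric] generate_field_eq)
  obtain q' where "(\<Prod>k<p. q \<circ>\<^sub>p [:0, \<zeta> ^ k:]) - [:w:] = (monom 1 p - [:v:]) * q'"
    using dvd by (rule dvdE)
  then have "ac_eval r ((\<Prod>k<p. q \<circ>\<^sub>p [:0, \<zeta> ^ k:]) - [:w:]) = 0"
    using r by (simp add: ac_eval_mult ac_eval_diff ac_eval_monom)
  then have prod: "(\<Prod>k<p. ac_eval (conj_root k) q) = to_ac w"
    by (simp add: ac_eval_diff ac_eval_prod ac_eval_pcompose conj_root_def)
  then have norm: "field_norm (range (ac_eval r)) (ac_eval r q) = w"
    using field_norm_eval[of q] by simp
  have "ac_eval r q \<noteq> 0"
  proof
    assume "ac_eval r q = 0"
    then have "(\<Prod>k<p. ac_eval (conj_root k) q) = 0"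
      using p_pos by (intro prod_zero) (auto intro!: bexI[of _ 0] simp: conj_root_def)
    with prod w show False by simp
  qed
  with norm show ?thesis unfolding norm_group_def E by force
qed

text \<open>All roots of \<open>t ^ p\<close> lie in the base field, which is therefore the whole extension, and the norm is
the determinant of a \<open>1 \<times> 1\<close> matrix.\<close>

lemma trivial_extension_norm_group:
  fixes t :: "'a::field"
  assumes p: "prime p" "primitive_root_of_unity p (\<zeta> :: 'a)" and t: "t \<noteq> 0" and w: "w \<noteq> 0"
  shows "w \<in> norm_group (root_extension p (t ^ p))"
proof -
  define r where "r = (SOME r. r ^ p = to_ac (t ^ p))"
  have r: "r ^ p = to_ac (t ^ p)"
    unfolding r_def by (rule someI_ex, rule nth_root_in_alg_closure) (use p in \<open>simp add: prime_gt_0_nat\<close>)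
  then have "(r / to_ac t) ^ p = 1" using t by (simp add: power_divide)
  then obtain k where "r / to_ac t = to_ac \<zeta> ^ k"
    using roots_of_unity_eq_powers[of p "to_ac \<zeta>"] p by (auto simp: primitive_root_to_ac)
  then have "r = to_ac (\<zeta> ^ k * t)" using t by (simp add: field_simps)
  then have ins: "insert r (range to_ac) = range to_ac" by blast
  have E: "root_extension p (t ^ p) = range to_ac"
    unfolding root_extension_def r_def[symmetric] ins
  proof
    show "generate_field field_ring (range to_ac) \<subseteq> range (to_ac :: 'a \<Rightarrow> _)"
      by (rule generate_field_subset)
        (auto simp flip: to_ac_add to_ac_mult to_ac_minus to_ac_inverse intro: range_eqI[of _ _ 1])
  qed (auto intro: generate_field.incl)
  have B: "finite {1 :: 'a alg_closure}" "\<not> ac_dependent {1 :: 'a alg_closure}"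
    "ac_span {1 :: 'a alg_closure} = range to_ac"
    by (simp_all add: ac.span_singleton ac_scale_def)
  define bs where "bs = (SOME bs. extension_basis (range (to_ac :: 'a \<Rightarrow> _)) bs)"
  have bs: "extension_basis (range to_ac) bs" unfolding bs_def by (rule extension_basis_exists[OF B])
  have "length bs = 1" using extension_basis_length[OF bs B(2,3)] by simp
  then obtain e where e: "bs = [e]" by (auto simp: length_Suc_conv)
  have "ac_representation {e} (ac_scale w e) e = w"
    using bs e ac.representation_scale[of "{e}" e w] ac.representation_basis[of "{e}" e]
      ac.span_base[of e "{e}"]
    by (simp add: extension_basis_def)
  then have "field_norm (range to_ac) (to_ac w) = w"
    by (simp add: field_norm_def Let_def bs_def[symmetric] e det_single ac_scale_def)
  moreover have "to_ac w \<in> range to_ac - {0}" using w by simp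
  ultimately show ?thesis unfolding norm_group_def E by (metis image_eqI)
qed

lemma pcompose_scaling: "[:0, a:] \<circ>\<^sub>p [:0, b:] = [:0, a * b :: 'a::comm_ring_1:]"
  by (simp add: pcompose_pCons)

text \<open>The commutation rule moves \<open>\<Phi>\<close> past a polynomial in \<open>J\<close> at the cost of rescaling its variable:
\<open>\<Phi> f(J) = f(\<omega> J) \<Phi>\<close>.  Hence \<open>\<Phi>\<close> is determined by the polynomial \<open>q\<close> with \<open>\<Phi> s = q(J) s\<close>, and its
\<open>p\<close>-th power is the product of the twists of \<open>q\<close>.\<close>

lemma (in vector_space) norm_of_split_pair:
  assumes p: "prime p" "p \<noteq> CHAR('a)" "primitive_root_of_unity p \<omega>"
    and nz: "v \<noteq> 0" "w \<noteq> 0"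
    and V: "subspace V" "dim_le scale V p" "s \<in> V" "s \<noteq> 0"
    and hom: "module_hom scale scale J" "module_hom scale scale \<Phi>"
    and inv: "\<And>x. x \<in> V \<Longrightarrow> J x \<in> V" "\<And>x. x \<in> V \<Longrightarrow> \<Phi> x \<in> V"
    and pow: "\<And>x. x \<in> V \<Longrightarrow> (J ^^ p) x = scale v x" "\<And>x. x \<in> V \<Longrightarrow> (\<Phi> ^^ p) x = scale w x"
    and comm: "\<And>x. x \<in> V \<Longrightarrow> \<Phi> (J x) = scale \<omega> (J (\<Phi> x))"
  shows "w \<in> norm_group (root_extension p v)"
proof (cases "\<exists>t. t ^ p = v")
  case True
  then obtain t where t: "v = t ^ p" by blast
  then have "t \<noteq> 0" using nz p by (auto simp: power_0_left prime_gt_0_nat)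
  with t show ?thesis using trivial_extension_norm_group[OF p(1,3)] nz(2) by simp
next
  case False
  interpret cyclic_operator scale J s
    using hom(1) by (simp add: cyclic_operator_def vector_space_axioms)
  interpret \<Phi>: module_hom scale scale \<Phi> by (rule hom(2))
  have p0: "p > 0" using p by (simp add: prime_gt_0_nat)
  let ?B = "(\<lambda>k. (J ^^ k) s) ` {..<p}"
  note ind = orbit_independent[OF hom(1) pow(1)[OF V(3)] V(4) p(1) nz(1) False]
  have JV: "(J ^^ k) s \<in> V" for k using V(3) inv(1) by (induction k) simp_all
  have "span ?B = V"
  proof (rule independent_span_eq[OF _ ind(2) _ V(2,1)])
    show "?B \<subseteq> V" using JV by auto
    show "p \<le> card ?B" using ind(1) by (simp add: card_image)
  qed simp
  then have "\<Phi> s \<in> range act" using span_orbit[of p] inv(2) V(3) by blast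
  then obtain q where q: "\<Phi> s = act q" by blast
  have actV: "act f \<in> V" for f
  proof (induction f)
    case (pCons a f)
    show ?case
      unfolding act_pCons by (intro subspace_add[OF V(1)] subspace_scale[OF V(1)] V(3) inv(1) pCons.IH)
  qed (simp add: subspace_0[OF V(1)])
  have \<Phi>act: "\<Phi> (act f) = act ((f \<circ>\<^sub>p [:0, \<omega>:]) * q)" for f
  proof (induction f)
    case (pCons a f)
    have "\<Phi> (act (pCons a f)) = scale a (act q) + scale \<omega> (J (\<Phi> (act f)))"
      by (simp only: act_pCons \<Phi>.add \<Phi>.scale q comm[OF actV])
    also have "\<dots> = act (smult a q + smult \<omega> (pCons 0 ((f \<circ>\<^sub>p [:0, \<omega>:]) * q)))"
      by (simp add: act_add act_smult pCons.IH J.scale)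
    also have "smult a q + smult \<omega> (pCons 0 ((f \<circ>\<^sub>p [:0, \<omega>:]) * q)) = (pCons a f \<circ>\<^sub>p [:0, \<omega>:]) * q"
      by (simp add: pcompose_pCons distrib_right mult.assoc)
    finally show ?case .
  qed (simp add: \<Phi>.zero)
  have "(\<Phi> ^^ k) s = act (\<Prod>i<k. q \<circ>\<^sub>p [:0, \<omega> ^ i:])" for k
  proof (induction k)
    case (Suc k)
    have 1: "(\<Prod>i<k. q \<circ>\<^sub>p [:0, \<omega> ^ i:]) \<circ>\<^sub>p [:0, \<omega>:] = (\<Prod>i<k. q \<circ>\<^sub>p [:0, \<omega> ^ Suc i:])"
      by (subst pcompose_prod, rule prod.cong[OF refl])
        (simp only: pcompose_assoc[symmetric] pcompose_scaling power_Suc2)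
    have "(\<Phi> ^^ Suc k) s = act ((\<Prod>i<k. q \<circ>\<^sub>p [:0, \<omega> ^ Suc i:]) * q)"
      by (simp only: funpow.simps comp_def Suc.IH \<Phi>act 1)
    also have "(\<Prod>i<k. q \<circ>\<^sub>p [:0, \<omega> ^ Suc i:]) * q = (\<Prod>i<Suc k. q \<circ>\<^sub>p [:0, \<omega> ^ i:])"
      by (subst prod.lessThan_Suc_shift) (simp only: power_0 pcompose_idR mult.commute)
    finally show ?case .
  qed (simp add: act_1)
  then have "act ((\<Prod>i<p. q \<circ>\<^sub>p [:0, \<omega> ^ i:]) - [:w:]) = 0"
    using pow(2)[OF V(3)] by (simp add: act_diff J.zero)
  then have "monom 1 p - [:v:] dvd (\<Prod>i<p. q \<circ>\<^sub>p [:0, \<omega> ^ i:]) - [:w:]"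
    by (rule act_eq_0_imp_dvd[OF pow(1)[OF V(3)] p0 ind])
  then show ?thesis by (rule radical_extension_norm_groupI[OF p nz(1) False nz(2)])
qed

section \<open>Pairs of operators that commute up to a root of unity\<close>

text \<open>Such a pair is an action of the symbol algebra \<open>(\<alpha>, \<beta>)\<close> with root of unity \<open>\<omega>\<close> on \<open>W\<close>.  The
operators are linear on the whole ambient space, but the relations are only imposed on \<open>W\<close>.\<close>

definition symbol_pair ::
    "('a::field \<Rightarrow> 'b::ab_group_add \<Rightarrow> 'b) \<Rightarrow> nat \<Rightarrow> 'b set \<Rightarrow> 'a \<Rightarrow> 'a \<Rightarrow> 'a \<Rightarrow> ('b \<Rightarrow> 'b) \<Rightarrow> ('b \<Rightarrow> 'b) \<Rightarrow> bool"
  where "symbol_pair scale p W \<omega> \<alpha> \<beta> P Q \<longleftrightarrow>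
    module_hom scale scale P \<and> module_hom scale scale Q \<and> P ` W \<subseteq> W \<and> Q ` W \<subseteq> W \<and>
    (\<forall>x\<in>W. Q (P x) = scale \<omega> (P (Q x))) \<and>
    (\<forall>x\<in>W. (P ^^ p) x = scale \<alpha> x) \<and> (\<forall>x\<in>W. (Q ^^ p) x = scale \<beta> x)"

definition commute_on :: "'b set \<Rightarrow> ('b \<Rightarrow> 'b) \<Rightarrow> ('b \<Rightarrow> 'b) \<Rightarrow> bool"
  where "commute_on W f g \<longleftrightarrow> (\<forall>x\<in>W. f (g x) = g (f x))"

lemma funpow_preserves:
  assumes "f ` W \<subseteq> W" "x \<in> W"
  shows "(f ^^ k) x \<in> W"
  using assms by (induction k) auto

lemma funpow_comp_commute_on:
  assumes "commute_on W f g" "f ` W \<subseteq> W" "g ` W \<subseteq> W" "x \<in> W"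
  shows "((f \<circ> g) ^^ k) x = (f ^^ k) ((g ^^ k) x)"
proof -
  have *: "g ((f ^^ k) y) = (f ^^ k) (g y)" if "y \<in> W" for k y
    using that
  proof (induction k)
    case (Suc k)
    have "g (f ((f ^^ k) y)) = f (g ((f ^^ k) y))"
      using assms(1) funpow_preserves[OF assms(2) Suc.prems] by (simp add: commute_on_def)
    with Suc show ?case by simp
  qed simp
  show ?thesis
  proof (induction k)
    case (Suc k)
    then show ?case using *[OF funpow_preserves[OF assms(3,4)], of k k] by simp
  qed simp
qed

lemma module_hom_comp:
  assumes "module_hom s s f" "module_hom s s g"
  shows "module_hom s s (f \<circ> g)"
proof -
  interpret f: module_hom s s f by fact
  interpret g: module_hom s s g by fact
  show ?thesis by unfold_locales (simp_all add: f.add f.scale g.add g.scale)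
qed

context vector_space begin

lemma symbol_pair_swap:
  assumes "symbol_pair scale p W \<omega> \<alpha> \<beta> P Q" "\<omega> \<noteq> 0"
  shows "symbol_pair scale p W (inverse \<omega>) \<beta> \<alpha> Q P"
  using assms by (simp add: symbol_pair_def)

lemma radical_operator_inverse:
  assumes W: "subspace W" and p: "p > 0" and hom: "module_hom scale scale P" and inv: "P ` W \<subseteq> W"
    and pow: "\<And>x. x \<in> W \<Longrightarrow> (P ^^ p) x = scale \<alpha> x" and nz: "\<alpha> \<noteq> 0"
  obtains P' where "module_hom scale scale P'" "P' ` W \<subseteq> W"
    "\<And>x. x \<in> W \<Longrightarrow> P (P' x) = x" "\<And>x. x \<in> W \<Longrightarrow> P' (P x) = x"
    "\<And>x. x \<in> W \<Longrightarrow> (P' ^^ p) x = scale (inverse \<alpha>) x"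
proof -
  interpret P: module_hom scale scale P by fact
  obtain m where m: "p = Suc m" using p by (cases p) auto
  define P' where "P' x = scale (inverse \<alpha>) ((P ^^ m) x)" for x
  interpret Pk: module_hom scale scale "P ^^ m" by (rule module_hom_funpow[OF hom])
  have hom': "module_hom scale scale P'"
    by unfold_locales (simp_all add: P'_def Pk.add Pk.scale scale_right_distrib mult.commute)
  have inv': "P' ` W \<subseteq> W"
    using funpow_preserves[OF inv] by (auto simp: P'_def intro!: subspace_scale[OF W])
  have 1: "P (P' x) = x" if "x \<in> W" for x
  proof -
    have "P (P' x) = scale (inverse \<alpha>) ((P ^^ p) x)" by (simp add: P'_def P.scale m)
    then show ?thesis using pow[OF that] nz by simp
  qed
  have 2: "P' (P x) = x" if "x \<in> W" for x
  proof -
    have "P' (P x) = scale (inverse \<alpha>) ((P ^^ p) x)" by (simp add: P'_def m funpow_swap1)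
    then show ?thesis using pow[OF that] nz by simp
  qed
  interpret P'p: module_hom scale scale "P' ^^ p" by (rule module_hom_funpow[OF hom'])
  \<comment> \<open>This avoids computing the power of \<open>P'\<close> from its definition.\<close>
  have "(P' ^^ k) ((P ^^ k) x) = x" if "x \<in> W" for k x
    using that
  proof (induction k)
    case (Suc k)
    have "(P' ^^ Suc k) ((P ^^ Suc k) x) = (P' ^^ k) (P' (P ((P ^^ k) x)))" by (simp add: funpow_swap1)
    then show ?case using Suc 2 funpow_preserves[OF inv] by simp
  qed simp
  then have "scale \<alpha> ((P' ^^ p) x) = x" if "x \<in> W" for x
    using that pow by (metis P'p.scale)
  then have 3: "(P' ^^ p) x = scale (inverse \<alpha>) x" if "x \<in> W" for x
    using that nz by (metis left_inverse scale_one scale_scale)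
  show ?thesis by (rule that[OF hom' inv' 1 2 3])
qed

text \<open>The inverse operators are polynomials in the given ones, so they still commute with every
operator that commutes with the given ones.\<close>

lemma symbol_pair_inverse:
  assumes W: "subspace W" and p: "p > 0" and nz: "\<omega> \<noteq> 0" "\<alpha> \<noteq> 0" "\<beta> \<noteq> 0"
    and PQ: "symbol_pair scale p W \<omega> \<alpha> \<beta> P Q"
  obtains P' Q' where "symbol_pair scale p W \<omega> (inverse \<alpha>) (inverse \<beta>) P' Q'"
    "\<And>f. f ` W \<subseteq> W \<Longrightarrow> commute_on W f P \<Longrightarrow> commute_on W f P'"
    "\<And>f. f ` W \<subseteq> W \<Longrightarrow> commute_on W f Q \<Longrightarrow> commute_on W f Q'"
proof -
  have PW: "P ` W \<subseteq> W" and QW: "Q ` W \<subseteq> W" using PQ by (auto simp: symbol_pair_def)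
  obtain P' where P': "module_hom scale scale P'" "P' ` W \<subseteq> W"
    "\<And>x. x \<in> W \<Longrightarrow> P (P' x) = x" "\<And>x. x \<in> W \<Longrightarrow> P' (P x) = x"
    "\<And>x. x \<in> W \<Longrightarrow> (P' ^^ p) x = scale (inverse \<alpha>) x"
    using radical_operator_inverse[OF W p, of P \<alpha>] PQ nz unfolding symbol_pair_def by blast
  obtain Q' where Q': "module_hom scale scale Q'" "Q' ` W \<subseteq> W"
    "\<And>x. x \<in> W \<Longrightarrow> Q (Q' x) = x" "\<And>x. x \<in> W \<Longrightarrow> Q' (Q x) = x"
    "\<And>x. x \<in> W \<Longrightarrow> (Q' ^^ p) x = scale (inverse \<beta>) x"
    using radical_operator_inverse[OF W p, of Q \<beta>] PQ nz unfolding symbol_pair_def by blast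
  interpret P': module_hom scale scale P' by fact
  interpret Q': module_hom scale scale Q' by fact
  have com: "commute_on W f g'"
    if "f ` W \<subseteq> W" "commute_on W f g" "g ` W \<subseteq> W" "g' ` W \<subseteq> W"
      "\<And>x. x \<in> W \<Longrightarrow> g (g' x) = x" "\<And>x. x \<in> W \<Longrightarrow> g' (g x) = x" for f g g'
    unfolding commute_on_def
  proof
    fix x assume x: "x \<in> W"
    then have g'x: "g' x \<in> W" using that by blast
    then have fg'x: "f (g' x) \<in> W" using that by blast
    have "g' (f x) = g' (f (g (g' x)))" using that x by simp
    also have "\<dots> = g' (g (f (g' x)))" using that(2) g'x by (simp add: commute_on_def)
    finally show "f (g' x) = g' (f x)" using that fg'x by simp
  qed
  have "Q' (P' x) = scale \<omega> (P' (Q' x))" if x: "x \<in> W" for x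
  proof -
    define y where "y = P' (Q' x)"
    have y: "y \<in> W" "Q' x \<in> W" using x P'(2) Q'(2) by (auto simp: y_def)
    then have Qy: "Q y \<in> W" using QW by blast
    have "x = Q (P y)" using P' Q' x y by (simp add: y_def)
    also have "\<dots> = scale \<omega> (P (Q y))" using PQ y by (simp add: symbol_pair_def)
    finally have "P' x = scale \<omega> (Q y)" using P'(4)[OF Qy] by (simp add: P'.scale)
    then show ?thesis using Q'(4)[OF y(1)] by (simp add: Q'.scale y_def)
  qed
  then have "symbol_pair scale p W \<omega> (inverse \<alpha>) (inverse \<beta>) P' Q'"
    using P' Q' by (simp add: symbol_pair_def)
  then show ?thesis
    using com[OF _ _ PW P'(2-4)] com[OF _ _ QW Q'(2-4)] by (rule that)
qed

text \<open>The vectors \<open>\<pi> s\<close> are the projections of \<open>x\<close> to the eigenspaces of \<open>T\<close>, up to the factor \<open>p\<close>; their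
sum is \<open>p x\<close>, so one of them is not zero.\<close>

lemma eigenvector_exists:
  fixes \<omega> :: 'a
  assumes \<omega>: "primitive_root_of_unity p \<omega>" and p: "prime p" "p \<noteq> CHAR('a)"
    and hom: "module_hom scale scale T" and W: "subspace W" "T ` W \<subseteq> W"
    and x: "x \<in> W" "x \<noteq> 0" and pow: "(T ^^ p) x = x"
  obtains \<mu> y where "y \<in> W" "y \<noteq> 0" "T y = scale \<mu> y" "\<mu> \<noteq> 0"
proof -
  interpret T: module_hom scale scale T by fact
  define \<pi> where "\<pi> s = (\<Sum>l<p. scale ((\<omega> ^ s) ^ l) ((T ^^ l) x))" for s
  have \<omega>0: "\<omega> \<noteq> 0" using \<omega> by (rule primitive_root_nonzero)
  have \<omega>p: "(\<omega> ^ s) ^ p = 1" for s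
    using \<omega> by (metis mult.commute power_mult power_one primitive_root_of_unity_def)
  have p0: "p > 0" using p by (simp add: prime_gt_0_nat)
  have eig: "T (\<pi> s) = scale (inverse (\<omega> ^ s)) (\<pi> s)" for s
  proof -
    define a where "a l = scale ((\<omega> ^ s) ^ l) ((T ^^ l) x)" for l
    have "a p = a 0" using pow \<omega>p by (simp add: a_def)
    moreover have "a 0 + (\<Sum>l<p. a (Suc l)) = (\<Sum>l<p. a l) + a p"
      using sum.lessThan_Suc_shift[of a p] sum.lessThan_Suc[of a p] by simp
    ultimately have sh: "(\<Sum>l<p. a (Suc l)) = \<pi> s" by (simp add: \<pi>_def a_def)
    have "T (\<pi> s) = (\<Sum>l<p. scale (inverse (\<omega> ^ s)) (a (Suc l)))"
      using \<omega>0 by (simp add: \<pi>_def a_def T.sum T.scale) (simp flip: mult.assoc)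
    then show ?thesis by (simp add: sh flip: scale_sum_right)
  qed
  have "(\<Sum>s<p. \<pi> s) = (\<Sum>l<p. scale (\<Sum>s<p. (\<omega> ^ l) ^ s) ((T ^^ l) x))"
    unfolding \<pi>_def by (subst sum.swap) (simp add: scale_sum_left mult.commute flip: power_mult)
  also have "\<dots> = (\<Sum>l<p. if l = 0 then scale (of_nat p) x else 0)"
  proof (rule sum.cong[OF refl])
    fix l assume l: "l \<in> {..<p}"
    have "\<omega> ^ l = 1 \<longleftrightarrow> l = 0" using \<omega> l by (auto simp: primitive_root_of_unity_def)
    then show "scale (\<Sum>s<p. (\<omega> ^ l) ^ s) ((T ^^ l) x) = (if l = 0 then scale (of_nat p) x else 0)"
      by (subst sum_roots_of_unity[OF \<omega>p]) simp
  qed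
  also have "\<dots> = scale (of_nat p) x" using p0 by simp
  finally have "(\<Sum>s<p. \<pi> s) \<noteq> 0" using x(2) prime_of_nat_nonzero[OF p] by simp
  then obtain s where s: "\<pi> s \<noteq> 0" by (meson sum.neutral)
  have "\<pi> s \<in> W"
    unfolding \<pi>_def
    by (intro subspace_sum[OF W(1)] subspace_scale[OF W(1)] funpow_preserves[OF W(2) x(1)])
  then show ?thesis using s eig[of s] \<omega>0 by (intro that[of "\<pi> s" "inverse (\<omega> ^ s)"]) auto
qed

text \<open>The space \<open>V\<close> is an eigenspace of \<open>T = P1 P2\<close>, whose \<open>p\<close>-th power is \<open>\<alpha> \<alpha>\<^sup>-\<^sup>1 = 1\<close>.  Since \<open>Q1\<close> multiplies
eigenvalues by \<open>\<omega>\<^sup>-\<^sup>1\<close> and \<open>Q2\<close> by \<open>\<omega>\<close>, the powers of \<open>Q1\<close> embed \<open>p\<close> independent copies of \<open>V\<close> into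
\<open>W\<close>, while \<open>Q1 Q2\<close> preserves \<open>V\<close>.  The two claims are the two ways of reading the resulting
pair; the second one uses \<open>P2\<close>, which on \<open>V\<close> is a multiple of the inverse of \<open>P1\<close>.\<close>

lemma norm_of_commuting_pairs:
  assumes p: "prime p" "p \<noteq> CHAR('a)" and \<omega>: "primitive_root_of_unity p \<omega>"
    and W: "subspace W" "dim_le scale W (p * p)" "x0 \<in> W" "x0 \<noteq> 0"
    and pair1: "symbol_pair scale p W \<omega> \<alpha> \<beta>1 P1 Q1"
    and pair2: "symbol_pair scale p W (inverse \<omega>) (inverse \<alpha>) \<beta>2 P2 Q2"
    and com: "commute_on W P1 P2" "commute_on W P1 Q2" "commute_on W Q1 P2" "commute_on W Q1 Q2"
    and nz: "\<alpha> \<noteq> 0" "\<beta>1 \<noteq> 0" "\<beta>2 \<noteq> 0"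
  shows "\<beta>1 * \<beta>2 \<in> norm_group (root_extension p \<alpha>)"
    and "inverse \<alpha> \<in> norm_group (root_extension p (\<beta>1 * \<beta>2))"
proof -
  have p0: "p > 0" using p by (simp add: prime_gt_0_nat)
  have \<omega>0: "\<omega> \<noteq> 0" using \<omega> by (rule primitive_root_nonzero)
  have hom: "module_hom scale scale P1" "module_hom scale scale Q1"
      "module_hom scale scale P2" "module_hom scale scale Q2"
    and img: "P1 ` W \<subseteq> W" "Q1 ` W \<subseteq> W" "P2 ` W \<subseteq> W" "Q2 ` W \<subseteq> W"
    using pair1 pair2 by (auto simp: symbol_pair_def)
  interpret P1: module_hom scale scale P1 by (rule hom)
  interpret Q1: module_hom scale scale Q1 by (rule hom)
  interpret P2: module_hom scale scale P2 by (rule hom)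
  interpret Q2: module_hom scale scale Q2 by (rule hom)
  have inW [simp]: "P1 x \<in> W" "Q1 x \<in> W" "P2 x \<in> W" "Q2 x \<in> W" if "x \<in> W" for x
    using img that by auto
  have rel1: "Q1 (P1 x) = scale \<omega> (P1 (Q1 x))" if "x \<in> W" for x
    using pair1 that by (simp add: symbol_pair_def)
  have rel2: "P2 (Q2 x) = scale \<omega> (Q2 (P2 x))" if "x \<in> W" for x
    using pair2 that \<omega>0 by (simp add: symbol_pair_def)
  have pows: "(P1 ^^ p) x = scale \<alpha> x" "(Q1 ^^ p) x = scale \<beta>1 x"
    "(P2 ^^ p) x = scale (inverse \<alpha>) x" "(Q2 ^^ p) x = scale \<beta>2 x" if "x \<in> W" for x
    using pair1 pair2 that by (auto simp: symbol_pair_def)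
  have c: "P2 (P1 x) = P1 (P2 x)" "Q2 (P1 x) = P1 (Q2 x)" "P2 (Q1 x) = Q1 (P2 x)"
    "Q2 (Q1 x) = Q1 (Q2 x)" if "x \<in> W" for x
    using com that by (auto simp: commute_on_def)
  define T where "T = P1 \<circ> P2"
  have homT: "module_hom scale scale T" unfolding T_def by (intro module_hom_comp hom)
  have TW: "T ` W \<subseteq> W" by (auto simp: T_def)
  have Tp: "(T ^^ p) x = x" if "x \<in> W" for x
    using funpow_comp_commute_on[OF com(1) img(1,3) that, of p] pows that nz
    by (simp add: T_def subspace_scale[OF W(1)])
  obtain \<mu> s where s: "s \<in> W" "s \<noteq> 0" "T s = scale \<mu> s" and \<mu>: "\<mu> \<noteq> 0"
    using eigenvector_exists[OF \<omega> p homT W(1) TW W(3,4) Tp[OF W(3)]] by blast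
  define V where "V = {x \<in> W. T x = scale \<mu> x}"
  interpret T: module_hom scale scale T by (rule homT)
  have V: "subspace V"
    using W(1) by (auto simp: subspace_def V_def T.zero T.add T.scale scale_right_distrib mult.commute)
  have Q1eig: "T ((Q1 ^^ k) x) = scale (\<mu> * inverse \<omega> ^ k) ((Q1 ^^ k) x) \<and> (Q1 ^^ k) x \<in> W"
    if "x \<in> V" for x k
  proof (induction k)
    case 0
    then show ?case using that by (simp add: V_def)
  next
    case (Suc k)
    define y where "y = (Q1 ^^ k) x"
    have y: "y \<in> W" "T y = scale (\<mu> * inverse \<omega> ^ k) y" using Suc by (simp_all add: y_def)
    have "scale \<omega> (T (Q1 y)) = Q1 (T y)" using y(1) by (simp add: T_def c rel1)
    also have "\<dots> = scale \<omega> (scale (\<mu> * inverse \<omega> ^ Suc k) (Q1 y))"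
      using \<omega>0 by (simp add: y(2) Q1.scale field_simps)
    finally have "T (Q1 y) = scale (\<mu> * inverse \<omega> ^ Suc k) (Q1 y)" using \<omega>0 by (simp only: scale_cancel_left) simp
    then show ?case using y(1) by (simp add: y_def)
  qed
  have Q1inj: "x = 0" if x: "x \<in> W" "(Q1 ^^ k) x = 0" "k < p" for x k
  proof -
    interpret Qk: module_hom scale scale "Q1 ^^ (p - k)" by (rule module_hom_funpow[OF hom(2)])
    have "(Q1 ^^ p) x = (Q1 ^^ (p - k)) ((Q1 ^^ k) x)"
      using x(3) by (simp flip: funpow_add[THEN fun_cong, unfolded comp_def])
    then have "scale \<beta>1 x = 0" using pows(2)[OF x(1)] x(2) by (simp add: Qk.zero)
    then show ?thesis using nz by simp
  qed
  have dimV: "dim_le scale V p"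
  proof (rule dim_le_direct_sum[OF W(2) V, of "{..<p}" "\<lambda>k. Q1 ^^ k"])
    show "module_hom scale scale (Q1 ^^ t)" for t by (rule module_hom_funpow[OF hom(2)])
    show "(Q1 ^^ t) x \<in> W" if "x \<in> V" for t x using Q1eig[OF that] by blast
    fix g assume g: "\<And>t. t \<in> {..<p} \<Longrightarrow> g t \<in> V" "(\<Sum>t<p. (Q1 ^^ t) (g t)) = 0"
    have "\<forall>t\<in>{..<p}. (Q1 ^^ t) (g t) = 0"
    proof (rule eigenvectors_sum_zero[OF _ homT _ _ g(2), where \<mu> = "\<lambda>k. \<mu> * inverse \<omega> ^ k"])
      show "inj_on (\<lambda>k. \<mu> * inverse \<omega> ^ k) {..<p}"
        using primitive_root_inj[OF primitive_root_inverse[OF \<omega>]] \<mu> by (simp add: inj_on_def)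
    qed (use Q1eig g(1) in auto)
    then show "\<forall>t\<in>{..<p}. g t = 0" using Q1inj g(1) by (auto simp: V_def)
  qed (use p0 in auto)
  have sV: "s \<in> V" using s by (simp add: V_def)
  have homQ: "module_hom scale scale (Q1 \<circ> Q2)" by (intro module_hom_comp hom)
  have PV: "P1 x \<in> V" "P2 x \<in> V" if "x \<in> V" for x
  proof -
    have "x \<in> W" using that by (simp add: V_def)
    then have "T (P1 x) = P1 (T x)" "T (P2 x) = P2 (T x)" by (simp_all add: T_def c)
    then show "P1 x \<in> V" "P2 x \<in> V" using that by (simp_all add: V_def P1.scale P2.scale)
  qed
  have QV: "(Q1 \<circ> Q2) x \<in> V" if "x \<in> V" for x
  proof -
    have xW: "x \<in> W" using that by (simp add: V_def)
    have "T (Q1 (Q2 x)) = Q1 (Q2 (T x))"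
      using xW by (simp add: T_def c rel1 rel2 P1.scale Q1.scale)
    then show ?thesis using that by (simp add: V_def Q1.scale Q2.scale)
  qed
  have powQ: "((Q1 \<circ> Q2) ^^ p) x = scale (\<beta>1 * \<beta>2) x" if "x \<in> V" for x
    using that funpow_comp_commute_on[OF com(4) img(2,4), of x p] pows
    by (simp add: V_def subspace_scale[OF W(1)])
  have powP: "(P1 ^^ p) x = scale \<alpha> x" "(P2 ^^ p) x = scale (inverse \<alpha>) x" if "x \<in> V" for x
    using that pows by (simp_all add: V_def)
  have relP1: "(Q1 \<circ> Q2) (P1 x) = scale \<omega> (P1 ((Q1 \<circ> Q2) x))" if "x \<in> V" for x
    using that by (simp add: V_def c rel1)
  have relP2: "P2 ((Q1 \<circ> Q2) x) = scale \<omega> ((Q1 \<circ> Q2) (P2 x))" if "x \<in> V" for x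
    using that by (simp add: V_def c rel2 Q1.scale)
  have nz': "\<beta>1 * \<beta>2 \<noteq> 0" "inverse \<alpha> \<noteq> 0" using nz by auto
  show "\<beta>1 * \<beta>2 \<in> norm_group (root_extension p \<alpha>)"
    by (rule norm_of_split_pair[OF p \<omega> nz(1) nz'(1) V dimV sV s(2) hom(1) homQ PV(1) QV powP(1) powQ relP1])
  show "inverse \<alpha> \<in> norm_group (root_extension p (\<beta>1 * \<beta>2))"
    by (rule norm_of_split_pair[OF p \<omega> nz' V dimV sV s(2) homQ hom(3) QV PV(2) powQ powP(2) relP2])
qed

end

section \<open>Symbol algebras are central simple\<close>

text \<open>A Brauer class is defined as the set of all central simple algebras that are equivalent to the
given one, and the class of an algebra that is not central simple would be empty.  So two equal
symbols yield an isomorphism of matrix algebras only once symbol algebras are known to be central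
simple.  They are treated as twisted group algebras of \<open>(\<int>/p)\<^sup>2\<close>: associativity is the cocycle identity.\<close>


lemma mod_add_div_eq:
  fixes a b p :: nat
  assumes "p > 0"
  shows "a div p + (a mod p + b) div p = (a + b) div p"
proof -
  have "(a + b) div p = (a mod p + b + p * (a div p)) div p" by (simp add: algebra_simps)
  also have "\<dots> = a div p + (a mod p + b) div p" using assms by (subst div_mult_self2) auto
  finally show ?thesis by simp
qed

locale symbol_params =
  fixes p :: nat and \<zeta> u v :: "'a::field"
  assumes p: "prime p" and zeta: "primitive_root_of_unity p \<zeta>" and nonzero: "u \<noteq> 0" "v \<noteq> 0"
begin

abbreviation "A \<equiv> symbol_algebra p \<zeta> u v"

definition "ind = {..<p} \<times> {..<p}"

definition idx_add :: "nat \<times> nat \<Rightarrow> nat \<times> nat \<Rightarrow> nat \<times> nat"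
  where "idx_add a b = ((fst a + fst b) mod p, (snd a + snd b) mod p)"

definition idx_neg :: "nat \<times> nat \<Rightarrow> nat \<times> nat"
  where "idx_neg a = ((p - fst a) mod p, (p - snd a) mod p)"

definition cocycle :: "nat \<times> nat \<Rightarrow> nat \<times> nat \<Rightarrow> 'a"
  where "cocycle a b =
    \<zeta> ^ (snd a * fst b) * u ^ ((fst a + fst b) div p) * v ^ ((snd a + snd b) div p)"

text \<open>The product of the symbol algebra, but as a total function on coefficient families: bilinearity
and associativity hold without restriction to the carrier.\<close>

definition mul :: "(nat \<times> nat \<Rightarrow> 'a) \<Rightarrow> (nat \<times> nat \<Rightarrow> 'a) \<Rightarrow> nat \<times> nat \<Rightarrow> 'a"
  where "mul f g t = (\<Sum>a\<in>ind. \<Sum>b\<in>ind. if idx_add a b = t then f a * g b * cocycle a b else 0)"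

definition monomial :: "nat \<times> nat \<Rightarrow> nat \<times> nat \<Rightarrow> 'a"
  where "monomial a b = (if b = a then 1 else 0)"

lemma p_gt_1: "p > 1" using p by (rule prime_gt_1_nat)

lemma p_pos [simp]: "0 < p" using p_gt_1 by simp

lemma finite_ind [simp]: "finite ind" by (simp add: ind_def)

lemma idx_add_closed [simp]: "idx_add a b \<in> ind"
  by (simp add: idx_add_def ind_def)

lemma idx_add_commute: "idx_add a b = idx_add b a"
  by (simp add: idx_add_def add.commute)

lemma idx_add_assoc: "idx_add (idx_add a b) c = idx_add a (idx_add b c)"
  by (simp add: idx_add_def mod_add_left_eq mod_add_right_eq add.assoc)

lemma idx_zero [simp]: "(0,0) \<in> ind" by (simp add: ind_def)

lemma idx_add_zero [simp]: "a \<in> ind \<Longrightarrow> idx_add (0,0) a = a" "a \<in> ind \<Longrightarrow> idx_add a (0,0) = a"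
  by (auto simp: idx_add_def ind_def)

lemma idx_neg_closed [simp]: "idx_neg a \<in> ind"
  by (simp add: idx_neg_def ind_def)

lemma idx_add_neg: "a \<in> ind \<Longrightarrow> idx_add (idx_neg a) a = (0,0)"
  by (auto simp: idx_add_def idx_neg_def ind_def mod_add_left_eq)

lemma idx_add_cancel [simp]:
  assumes "a \<in> ind" "b \<in> ind" "b' \<in> ind"
  shows "idx_add a b = idx_add a b' \<longleftrightarrow> b = b'"
  using assms idx_add_assoc[of "idx_neg a" a] by (metis idx_add_neg idx_add_zero(1))

lemma idx_add_surj:
  assumes "a \<in> ind" "t \<in> ind"
  obtains b where "b \<in> ind" "idx_add a b = t"
proof
  show "idx_add a (idx_add (idx_neg a) t) = t"
    using assms idx_add_assoc[of a "idx_neg a" t] by (simp add: idx_add_commute[of a] idx_add_neg)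
qed simp

lemma cocycle_nonzero [simp]: "cocycle a b \<noteq> 0"
  using nonzero primitive_root_nonzero[OF zeta] by (simp add: cocycle_def)

lemma cocycle_zero [simp]: "a \<in> ind \<Longrightarrow> cocycle (0,0) a = 1" "a \<in> ind \<Longrightarrow> cocycle a (0,0) = 1"
  by (auto simp: cocycle_def ind_def)

lemma zeta_power_cong: "m mod p = n mod p \<Longrightarrow> \<zeta> ^ m = \<zeta> ^ n"
  using primitive_root_power_mod[OF zeta] by metis

lemma cocycle_assoc: "cocycle a b * cocycle (idx_add a b) c = cocycle b c * cocycle a (idx_add b c)"
proof -
  have z1: "\<zeta> ^ ((snd a + snd b) mod p * fst c) = \<zeta> ^ (snd a * fst c + snd b * fst c)"
    by (rule zeta_power_cong) (simp add: mod_mult_left_eq distrib_right)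
  have z2: "\<zeta> ^ (snd a * ((fst b + fst c) mod p)) = \<zeta> ^ (snd a * fst b + snd a * fst c)"
    by (rule zeta_power_cong) (simp add: mod_mult_right_eq distrib_left)
  have d: "x ^ ((k + m) div p) * x ^ (((k + m) mod p + n) div p)
      = x ^ ((m + n) div p) * x ^ ((k + (m + n) mod p) div p)" for x :: 'a and k m n
    using mod_add_div_eq[of p "k + m" n] mod_add_div_eq[of p "m + n" k]
    by (simp add: add.commute add.left_commute flip: power_add)
  show ?thesis
    using d[of u "fst a" "fst b" "fst c"] d[of v "snd a" "snd b" "snd c"]
    by (simp add: cocycle_def idx_add_def z1 z2 power_add mult.assoc mult.left_commute)
qed

text \<open>The linear extension of \<open>h\<close>, evaluated at a product; it reduces associativity to
\<open>cocycle_assoc\<close>.\<close>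

lemma sum_mul:
  "(\<Sum>r\<in>ind. mul f g r * h r) = (\<Sum>a\<in>ind. \<Sum>b\<in>ind. f a * g b * cocycle a b * h (idx_add a b))"
proof -
  have "(\<Sum>r\<in>ind. mul f g r * h r)
      = (\<Sum>a\<in>ind. \<Sum>b\<in>ind. \<Sum>r\<in>ind. if idx_add a b = r then f a * g b * cocycle a b * h r else 0)"
    unfolding mul_def sum_distrib_right
    by (subst sum.swap, rule sum.cong[OF refl], subst sum.swap)
      (auto intro!: sum.cong)
  then show ?thesis by simp
qed

lemma mul_assoc: "mul (mul f g) h = mul f (mul g h)"
proof
  fix t
  have "mul (mul f g) h t
      = (\<Sum>r\<in>ind. mul f g r * (\<Sum>d\<in>ind. if idx_add r d = t then h d * cocycle r d else 0))"
    unfolding mul_def[of "mul f g"] sum_distrib_left by (intro sum.cong refl) simp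
  also have "\<dots> = (\<Sum>a\<in>ind. \<Sum>b\<in>ind. \<Sum>d\<in>ind. if idx_add (idx_add a b) d = t
      then f a * g b * h d * (cocycle a b * cocycle (idx_add a b) d) else 0)"
    unfolding sum_mul
    by (rule sum.cong[OF refl], rule sum.cong[OF refl], subst sum_distrib_left, rule sum.cong[OF refl]) simp
  also have "\<dots> = (\<Sum>a\<in>ind. \<Sum>b\<in>ind. \<Sum>d\<in>ind. if idx_add a (idx_add b d) = t
      then f a * g b * h d * (cocycle b d * cocycle a (idx_add b d)) else 0)"
    by (simp only: cocycle_assoc idx_add_assoc)
  also have "\<dots> = (\<Sum>a\<in>ind. \<Sum>r\<in>ind. mul g h r * (if idx_add a r = t then f a * cocycle a r else 0))"
    unfolding sum_mul by (intro sum.cong refl) simp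
  also have "\<dots> = mul f (mul g h) t"
    unfolding mul_def[of f] by (intro sum.cong refl) simp
  finally show "mul (mul f g) h t = mul f (mul g h) t" .
qed

lemma mul_add_left: "mul (f + g) h = mul f h + mul g h"
  by (rule ext) (simp add: mul_def distrib_right flip: sum.distrib cong: if_cong,
    intro sum.cong refl, simp)

lemma mul_add_right: "mul f (g + h) = mul f g + mul f h"
  by (rule ext) (simp add: mul_def distrib_left distrib_right flip: sum.distrib cong: if_cong,
    intro sum.cong refl, simp)

lemma mul_scale_left: "mul (\<lambda>t. c * f t) g = (\<lambda>t. c * mul f g t)"
  by (rule ext) (simp add: mul_def sum_distrib_left, intro sum.cong refl, simp)

lemma mul_scale_right: "mul f (\<lambda>t. c * g t) = (\<lambda>t. c * mul f g t)"
  by (rule ext) (simp add: mul_def sum_distrib_left, intro sum.cong refl, simp)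

lemma mul_monomial_left:
  assumes "a \<in> ind" "b \<in> ind"
  shows "mul (monomial a) f (idx_add a b) = f b * cocycle a b"
proof -
  have "mul (monomial a) f (idx_add a b) = (\<Sum>a'\<in>ind. if a' = a then
      (\<Sum>b'\<in>ind. if idx_add a' b' = idx_add a b then f b' * cocycle a' b' else 0) else 0)"
    unfolding mul_def by (rule sum.cong[OF refl]) (simp add: monomial_def cong: if_cong)
  also have "\<dots> = (\<Sum>b'\<in>ind. if idx_add a b' = idx_add a b then f b' * cocycle a b' else 0)"
    using assms by simp
  also have "\<dots> = (\<Sum>b'\<in>ind. if b' = b then f b' * cocycle a b' else 0)"
    using assms by (intro sum.cong refl) simp
  finally show ?thesis using assms by simp
qed

lemma mul_monomial_right:
  assumes "a \<in> ind" "b \<in> ind"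
  shows "mul f (monomial a) (idx_add a b) = f b * cocycle b a"
proof -
  have "mul f (monomial a) (idx_add a b) = (\<Sum>b'\<in>ind. \<Sum>a'\<in>ind. if a' = a then
      (if idx_add a b' = idx_add a b then f b' * cocycle b' a else 0) else 0)"
    unfolding mul_def by (intro sum.cong refl) (simp add: monomial_def idx_add_commute)
  also have "\<dots> = (\<Sum>b'\<in>ind. if idx_add a b' = idx_add a b then f b' * cocycle b' a else 0)"
    using assms by simp
  also have "\<dots> = (\<Sum>b'\<in>ind. if b' = b then f b' * cocycle b' a else 0)"
    using assms by (intro sum.cong refl) simp
  finally show ?thesis using assms by simp
qed

lemma carrier_iff: "f \<in> carrier A \<longleftrightarrow> (\<forall>t. t \<notin> ind \<longrightarrow> f t = 0)"
  by (auto simp: symbol_algebra_def ind_def)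

lemma mul_closed [simp]: "mul f g \<in> carrier A"
proof -
  have "mul f g t = 0" if "t \<notin> ind" for t
    using that idx_add_closed unfolding mul_def by (intro sum.neutral ballI) metis
  then show ?thesis by (simp add: carrier_iff)
qed

lemma monomial_closed [simp]: "a \<in> ind \<Longrightarrow> monomial a \<in> carrier A"
  by (auto simp: carrier_iff monomial_def)

lemma carrier_eqI:
  assumes "f \<in> carrier A" "g \<in> carrier A" "a \<in> ind" "\<And>b. b \<in> ind \<Longrightarrow> f (idx_add a b) = g (idx_add a b)"
  shows "f = g"
proof
  fix t show "f t = g t"
  proof (cases "t \<in> ind")
    case True
    then show ?thesis using idx_add_surj[OF assms(3)] assms(4) by metis
  qed (metis assms(1,2) carrier_iff)
qed

lemma mul_one_left [simp]: "f \<in> carrier A \<Longrightarrow> mul (monomial (0,0)) f = f"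
  by (rule carrier_eqI[of _ _ "(0,0)"]) (auto simp del: idx_add_zero simp: mul_monomial_left, simp)

lemma mul_one_right [simp]: "f \<in> carrier A \<Longrightarrow> mul f (monomial (0,0)) = f"
  by (rule carrier_eqI[of _ _ "(0,0)"]) (auto simp del: idx_add_zero simp: mul_monomial_right, simp)

lemma mul_monomials:
  assumes "a \<in> ind" "b \<in> ind"
  shows "mul (monomial a) (monomial b) = (\<lambda>t. cocycle a b * monomial (idx_add a b) t)"
proof (rule carrier_eqI[OF mul_closed _ assms(1)])
  show "(\<lambda>t. cocycle a b * monomial (idx_add a b) t) \<in> carrier A"
    using idx_add_closed[of a b] by (auto simp: carrier_iff monomial_def)
qed (use assms in \<open>auto simp: mul_monomial_left monomial_def\<close>)

lemma symbol_algebra_simps [simp]: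
  "monoid.mult A = mul" "monoid.one A = monomial (0,0)" "ring.zero A = 0" "ring.add A = (+)" "module.smult A = (\<lambda>c f t. c * f t)"
proof -
  show "monoid.mult A = mul"
  proof (intro ext)
    fix f g and t :: "nat \<times> nat"
    obtain r s where t: "t = (r, s)" by (cases t)
    have "monoid.mult A f g (r, s) = (\<Sum>k<p. \<Sum>l<p. \<Sum>b\<in>ind.
        if idx_add (k,l) b = (r,s) then f (k,l) * g b * cocycle (k,l) b else 0)"
      unfolding symbol_algebra_def ind_def sum.cartesian_product'[symmetric]
      by (simp add: idx_add_def cocycle_def mult.assoc case_prod_unfold sum.cartesian_product' cong: if_cong)
    also have "\<dots> = mul f g t"
      by (simp add: mul_def t ind_def sum.cartesian_product')
    finally show "monoid.mult A f g t = mul f g t" by (simp add: t)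
  qed
qed (auto simp: symbol_algebra_def monomial_def fun_eq_iff)

lemma abelian_group_A: "abelian_group A"
proof (rule abelian_groupI)
  fix f assume f: "f \<in> carrier A"
  show "\<exists>g\<in>carrier A. g \<oplus>\<^bsub>A\<^esub> f = \<zero>\<^bsub>A\<^esub>"
    using f by (intro bexI[of _ "- f"]) (auto simp: carrier_iff)
qed (auto simp: carrier_iff add.assoc add.commute)

lemma ring_A: "ring A"
proof (rule ringI[OF abelian_group_A])
  show "Group.monoid A"
    by (rule monoidI) (auto simp: mul_assoc)
qed (auto simp: mul_add_left mul_add_right)

lemma scale_closed [simp]: "f \<in> carrier A \<Longrightarrow> (\<lambda>t. c * f t) \<in> carrier A"
  by (simp add: carrier_iff)

lemma module_A: "Module.module field_ring A"
  by (rule moduleI[OF cring_from_type_algebra abelian_group_A])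
    (simp_all add: ring_of_type_algebra_def fun_eq_iff distrib_right distrib_left mult.assoc)

lemma assoc_algebra_A: "assoc_algebra A"
  using ring_A module_A by (auto simp: assoc_algebra_def mul_scale_left mul_scale_right)

lemma scalars_A: "scalars A = range (\<lambda>c t. c * monomial (0,0) t)"
  by (simp add: scalars_def)

text \<open>The monomials are added to the span one after the other.\<close>

lemma finite_dimension_A: "ring.finite_dimension A (scalars A) (carrier A)"
proof -
  interpret A: ring A by (rule ring_A)
  have "A.dimension (card S) (scalars A) {f \<in> carrier A. \<forall>t. t \<notin> S \<longrightarrow> f t = 0}" if "finite S" "S \<subseteq> ind" for S
    using that
  proof (induction S rule: finite_induct)
    case empty
    have "{f \<in> carrier A. \<forall>t. t \<notin> {} \<longrightarrow> f t = 0} = {\<zero>\<^bsub>A\<^esub>}" by (auto simp: carrier_iff fun_eq_iff)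
    then show ?case using A.zero_dim by (simp only: card.empty)
  next
    case (insert a S)
    let ?E = "{f \<in> carrier A. \<forall>t. t \<notin> S \<longrightarrow> f t = 0}"
    have a: "a \<in> ind" using insert by simp
    have eq: "A.line_extension (scalars A) (monomial a) ?E
        = {f \<in> carrier A. \<forall>t. t \<notin> insert a S \<longrightarrow> f t = 0}" (is "?L = ?R")
    proof
      show "?L \<subseteq> ?R"
      proof
        fix f assume "f \<in> ?L"
        then obtain k g where kg: "k \<in> scalars A" "g \<in> ?E" "f = k \<otimes>\<^bsub>A\<^esub> monomial a \<oplus>\<^bsub>A\<^esub> g"
          unfolding A.line_extension_mem_iff by blast
        from kg(1) obtain c where "k = (\<lambda>t. c * monomial (0,0) t)" unfolding scalars_A by blast
        with kg(3) a have "f = (\<lambda>t. c * monomial a t) + g" by (simp add: mul_scale_left)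
        with kg(2) show "f \<in> ?R" using a by (simp add: carrier_iff monomial_def)
      qed
      show "?R \<subseteq> ?L"
      proof
        fix f assume f: "f \<in> ?R"
        let ?k = "\<lambda>t. f a * monomial (0,0) t" and ?g = "\<lambda>t. if t = a then 0 else f t"
        have "?g \<in> ?E" using f by (simp add: carrier_iff)
        moreover have "f = ?k \<otimes>\<^bsub>A\<^esub> monomial a \<oplus>\<^bsub>A\<^esub> ?g"
          using a by (simp add: mul_scale_left) (simp add: fun_eq_iff monomial_def)
        ultimately show "f \<in> ?L"
          unfolding A.line_extension_mem_iff scalars_A by (intro bexI[of _ ?k] bexI[of _ ?g] rangeI)
      qed
    qed
    have nE: "monomial a \<notin> ?E"
    proof
      assume "monomial a \<in> ?E"
      then have "monomial a a = 0" using insert.hyps(2) by blast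
      then show False by (simp add: monomial_def)
    qed
    have "A.dimension (Suc (card S)) (scalars A) (A.line_extension (scalars A) (monomial a) ?E)"
      by (rule A.Suc_dim[OF monomial_closed[OF a] nE insert.IH]) (use insert.prems in simp)
    then show ?case unfolding eq by (simp only: card_insert_disjoint[OF insert.hyps])
  qed
  from this[OF finite_ind subset_refl]
  have "A.dimension (card ind) (scalars A) {f \<in> carrier A. \<forall>t. t \<notin> ind \<longrightarrow> f t = 0}" .
  moreover have "{f \<in> carrier A. \<forall>t. t \<notin> ind \<longrightarrow> f t = 0} = carrier A"
    by (rule subset_antisym) (simp_all add: carrier_iff subset_iff)
  ultimately have "A.dimension (card ind) (scalars A) (carrier A)" by (simp only:)
  then show ?thesis unfolding A.finite_dimension_def over_def by (rule exI)
qed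

lemma generators_in_ind [simp]: "(Suc 0, 0) \<in> ind" "(0, Suc 0) \<in> ind"
  using p_gt_1 by (auto simp: ind_def)

lemma cocycle_swap:
  assumes "b \<in> ind"
  shows "cocycle b (Suc 0, 0) = \<zeta> ^ snd b * cocycle (Suc 0, 0) b"
    and "cocycle (0, Suc 0) b = \<zeta> ^ fst b * cocycle b (0, Suc 0)"
  using assms by (auto simp: cocycle_def ind_def)

lemma zeta_power_inj: "k < p \<Longrightarrow> l < p \<Longrightarrow> \<zeta> ^ k = \<zeta> ^ l \<longleftrightarrow> k = l"
  using primitive_root_inj[OF zeta] by (auto simp: inj_on_def)

text \<open>A coefficient at \<open>b\<close> survives commutation with \<open>i\<close> and \<open>j\<close> only if both powers of \<open>\<zeta>\<close> in
\<open>cocycle_swap\<close> are \<open>1\<close>, that is for \<open>b = (0, 0)\<close>.\<close>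

lemma center_A: "algebra_center A = scalars A"
proof
  show "scalars A \<subseteq> algebra_center A"
    by (auto simp: scalars_A algebra_center_def mul_scale_left mul_scale_right)
  show "algebra_center A \<subseteq> scalars A"
  proof
    fix z assume z: "z \<in> algebra_center A"
    then have zc: "z \<in> carrier A" by (simp add: algebra_center_def)
    have com: "z b * cocycle b a = z b * cocycle a b" if "a \<in> ind" "b \<in> ind" for a b
    proof -
      have "mul z (monomial a) = mul (monomial a) z" using z that by (simp add: algebra_center_def)
      then show ?thesis using mul_monomial_left[OF that, of z] mul_monomial_right[OF that, of z] by metis
    qed
    have "z b = 0" if "b \<noteq> (0,0)" for b
    proof (rule ccontr)
      assume nz: "z b \<noteq> 0"
      then have b: "b \<in> ind" using zc carrier_iff by blast
      have "\<zeta> ^ snd b = \<zeta> ^ 0" "\<zeta> ^ fst b = \<zeta> ^ 0"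
        using com[OF _ b, of "(Suc 0, 0)"] com[OF _ b, of "(0, Suc 0)"] nz cocycle_swap[OF b] by auto
      then have "snd b = 0" "fst b = 0" using b zeta_power_inj by (auto simp: ind_def simp del: power_0)
      with that show False by (simp add: prod_eq_iff)
    qed
    then have "z = (\<lambda>t. z (0,0) * monomial (0,0) t)" by (auto simp: monomial_def)
    then show "z \<in> scalars A" by (auto simp: scalars_A)
  qed
qed

text \<open>A nonzero element of an ideal with the fewest coefficients is a multiple of a monomial:
  subtracting a multiple of \<open>f i\<close> from \<open>i f\<close>, or of \<open>f j\<close> from \<open>j f\<close>, removes one coefficient and
  keeps another one.\<close>

lemma simple_A:
  assumes I: "ideal I A"
  shows "I = {\<zero>\<^bsub>A\<^esub>} \<or> I = carrier A"
proof (cases "I \<subseteq> {0}")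
  case True
  have "\<zero>\<^bsub>A\<^esub> \<in> I" by (rule additive_subgroup.zero_closed) (rule ideal.axioms(1)[OF I])
  with True show ?thesis by auto
next
  case False
  interpret I: ideal I A by (rule I)
  have Icarr: "f \<in> I \<Longrightarrow> f \<in> carrier A" for f using I.a_subset by blast
  have Iadd: "f \<in> I \<Longrightarrow> g \<in> I \<Longrightarrow> f + g \<in> I" for f g using additive_subgroup.a_closed[OF ideal.axioms(1)[OF I]] by simp
  have Il: "f \<in> I \<Longrightarrow> g \<in> carrier A \<Longrightarrow> mul g f \<in> I" for f g using I.I_l_closed by simp
  have Ir: "f \<in> I \<Longrightarrow> g \<in> carrier A \<Longrightarrow> mul f g \<in> I" for f g using I.I_r_closed by simp
  have Is: "(\<lambda>t. c * f t) \<in> I" if "f \<in> I" for c f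
    using Il[OF that, of "\<lambda>t. c * monomial (0,0) t"] Icarr[OF that] by (simp add: mul_scale_left)
  let ?supp = "\<lambda>f :: _ \<Rightarrow> 'a. {b \<in> ind. f b \<noteq> 0}"
  from False obtain f1 where "f1 \<in> I \<and> f1 \<noteq> 0" by auto
  then obtain f where f: "f \<in> I" "f \<noteq> 0" and min: "\<And>g. g \<in> I \<Longrightarrow> g \<noteq> 0 \<Longrightarrow> card (?supp f) \<le> card (?supp g)"
    using ex_has_least_nat[of "\<lambda>f. f \<in> I \<and> f \<noteq> 0" f1 "\<lambda>f. card (?supp f)"] by blast
  then obtain b where b: "f b \<noteq> 0" by (auto simp: fun_eq_iff)
  then have bi: "b \<in> ind" using Icarr[OF f(1)] carrier_iff by blast
  have single: "f b' = 0" if bb: "b' \<noteq> b" for b'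
  proof (rule ccontr)
    assume b': "f b' \<noteq> 0"
    then have b'i: "b' \<in> ind" using Icarr[OF f(1)] carrier_iff by blast
    obtain a where a: "a \<in> ind" and ne: "cocycle a b * cocycle b' a \<noteq> cocycle a b' * cocycle b a"
    proof (cases "snd b = snd b'")
      case True
      with bb have "fst b \<noteq> fst b'" by (simp add: prod_eq_iff)
      then have "\<zeta> ^ fst b \<noteq> \<zeta> ^ fst b'" using bi b'i zeta_power_inj by (auto simp: ind_def)
      then show ?thesis
        by (intro that[of "(0, Suc 0)"]) (simp_all add: cocycle_swap(2)[OF bi] cocycle_swap(2)[OF b'i])
    next
      case False
      then have "\<zeta> ^ snd b \<noteq> \<zeta> ^ snd b'" using bi b'i zeta_power_inj by (auto simp: ind_def)
      then show ?thesis
        by (intro that[of "(Suc 0, 0)"]) (simp_all add: cocycle_swap(1)[OF bi] cocycle_swap(1)[OF b'i])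
    qed
    define g where "g = mul (monomial a) f + (\<lambda>t. - (cocycle a b / cocycle b a) * mul f (monomial a) t)"
    have gI: "g \<in> I" unfolding g_def by (intro Iadd Is Il Ir f monomial_closed a)
    have gx: "g (idx_add a x) = f x * (cocycle a x - cocycle a b / cocycle b a * cocycle x a)" if "x \<in> ind" for x
      using mul_monomial_left[OF a that, of f] mul_monomial_right[OF a that, of f]
      by (simp add: g_def algebra_simps)
    have "g (idx_add a b') \<noteq> 0" using ne b' by (simp add: gx[OF b'i] field_simps)
    then have g0: "g \<noteq> 0" by auto
    have "?supp g \<subseteq> idx_add a ` (?supp f - {b})"
    proof
      fix t assume t: "t \<in> ?supp g"
      then obtain x where x: "x \<in> ind" "idx_add a x = t" using idx_add_surj[OF a] by blast
      with t gx[OF x(1)] have "f x \<noteq> 0" "x \<noteq> b" by auto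
      with x show "t \<in> idx_add a ` (?supp f - {b})" by blast
    qed
    then have "card (?supp g) \<le> card (idx_add a ` (?supp f - {b}))" by (intro card_mono) auto
    also have "\<dots> \<le> card (?supp f - {b})" by (intro card_image_le) auto
    also have "\<dots> < card (?supp f)" using b bi by (intro psubset_card_mono) auto
    finally show False using min[OF gI g0] by simp
  qed
  have fb: "f = (\<lambda>t. f b * monomial b t)" using single by (auto simp: monomial_def)
  let ?n = "idx_neg b"
  have "mul (monomial ?n) f = (\<lambda>t. f b * (cocycle ?n b * monomial (0,0) t))"
    by (subst fb) (simp add: mul_scale_right mul_monomials bi idx_add_neg)
  then have "(\<lambda>t. f b * (cocycle ?n b * monomial (0,0) t)) \<in> I" using Il[OF f(1), of "monomial ?n"] by simp
  from Is[OF this, of "inverse (f b * cocycle ?n b)"]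
  have "(\<lambda>t. inverse (f b * cocycle ?n b) * (f b * (cocycle ?n b * monomial (0,0) t))) \<in> I" .
  also have "(\<lambda>t. inverse (f b * cocycle ?n b) * (f b * (cocycle ?n b * monomial (0,0) t))) = monomial (0,0)"
  proof
    fix t
    have "inverse (f b * cocycle ?n b) * (f b * (cocycle ?n b * monomial (0,0) t))
        = (inverse (f b * cocycle ?n b) * (f b * cocycle ?n b)) * monomial (0,0) t"
      by (simp only: mult.assoc)
    also have "inverse (f b * cocycle ?n b) * (f b * cocycle ?n b) = 1"
      using b by (intro left_inverse) simp
    finally show "inverse (f b * cocycle ?n b) * (f b * (cocycle ?n b * monomial (0,0) t)) = monomial (0,0) t"
      by simp
  qed
  finally have "monomial (0,0) \<in> I" .
  then have "I = carrier A" using I.one_imp_carrier by simp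
  then show ?thesis by simp
qed

lemma monomial_nonzero: "monomial a \<noteq> 0"
proof
  assume "monomial a = 0"
  then have "monomial a a = 0" by simp
  then show False by (simp add: monomial_def)
qed

lemma central_simple_A: "central_simple_algebra A"
  unfolding central_simple_algebra_def
proof (intro conjI allI impI)
  show "carrier A \<noteq> {\<zero>\<^bsub>A\<^esub>}"
    using monomial_closed[OF idx_zero] monomial_nonzero[of "(0,0)"]
    by (metis singletonD symbol_algebra_simps(3))
qed (fact assoc_algebra_A finite_dimension_A center_A | erule simple_A)+

abbreviation "gen_i \<equiv> monomial (Suc 0, 0)"
abbreviation "gen_j \<equiv> monomial (0, Suc 0)"

lemma gen_j_gen_i: "mul gen_j gen_i = (\<lambda>t. \<zeta> * mul gen_i gen_j t)"
proof -
  have "cocycle (0, Suc 0) (Suc 0, 0) = \<zeta>" "cocycle (Suc 0, 0) (0, Suc 0) = 1"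
    using p_gt_1 by (simp_all add: cocycle_def)
  then show ?thesis
    by (simp only: mul_monomials generators_in_ind idx_add_commute[of "(0, Suc 0)"] mult_1_left)
qed

primrec mul_power :: "(nat \<times> nat \<Rightarrow> 'a) \<Rightarrow> nat \<Rightarrow> nat \<times> nat \<Rightarrow> 'a"
  where "mul_power f 0 = monomial (0,0)" | "mul_power f (Suc n) = mul f (mul_power f n)"

lemma mul_power_gen_i: "k < p \<Longrightarrow> mul_power gen_i k = monomial (k, 0)"
proof (induction k)
  case (Suc k)
  then have "(k, 0) \<in> ind" "idx_add (Suc 0, 0) (k, 0) = (Suc k, 0)" "cocycle (Suc 0, 0) (k, 0) = 1"
    by (simp_all add: ind_def idx_add_def cocycle_def)
  with Suc show ?case by (simp add: mul_monomials)
qed simp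

lemma mul_power_gen_j: "k < p \<Longrightarrow> mul_power gen_j k = monomial (0, k)"
proof (induction k)
  case (Suc k)
  then have "(0, k) \<in> ind" "idx_add (0, Suc 0) (0, k) = (0, Suc k)" "cocycle (0, Suc 0) (0, k) = 1"
    by (simp_all add: ind_def idx_add_def cocycle_def)
  with Suc show ?case by (simp add: mul_monomials)
qed simp

lemma gen_i_power: "mul_power gen_i p = (\<lambda>t. u * monomial (0,0) t)"
  and gen_j_power: "mul_power gen_j p = (\<lambda>t. v * monomial (0,0) t)"
proof -
  obtain m where m: "Suc m = p" using p_gt_1 by (cases p) auto
  then have mp: "m < p" by simp
  have m_ind: "(m, 0) \<in> ind" "(0, m) \<in> ind" using mp by (auto simp: ind_def)
  have md: "Suc m mod p = 0" "Suc m div p = 1" unfolding m by auto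
  have "mul_power gen_i (Suc m) = (\<lambda>t. u * monomial (0,0) t)"
    using m_ind md by (simp add: mul_power_gen_i[OF mp] mul_power_gen_j[OF mp] mul_monomials idx_add_def cocycle_def)
  then show "mul_power gen_i p = (\<lambda>t. u * monomial (0,0) t)" by (simp only: m)
  have "mul_power gen_j (Suc m) = (\<lambda>t. v * monomial (0,0) t)"
    using m_ind md by (simp add: mul_power_gen_i[OF mp] mul_power_gen_j[OF mp] mul_monomials idx_add_def cocycle_def)
  then show "mul_power gen_j p = (\<lambda>t. v * monomial (0,0) t)" by (simp only: m)
qed

end

section \<open>Matrices over a symbol algebra\<close>

definition vscale :: "'a::field \<Rightarrow> (nat \<Rightarrow> nat \<times> nat \<Rightarrow> 'a) \<Rightarrow> nat \<Rightarrow> nat \<times> nat \<Rightarrow> 'a"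
  where "vscale c x = (\<lambda>i t. c * x i t)"

interpretation vec: vector_space "vscale :: 'a::field \<Rightarrow> _"
  by unfold_locales (simp_all add: vscale_def fun_eq_iff algebra_simps)

lemma sum_fun_apply: "(\<Sum>i\<in>S. f i) t = (\<Sum>i\<in>S. f i t :: 'b::comm_monoid_add)"
  by (induction S rule: infinite_finite_induct) simp_all

definition elem_matrix :: "nat \<Rightarrow> nat \<Rightarrow> nat \<Rightarrow> (nat \<times> nat \<Rightarrow> 'a) \<Rightarrow> nat \<times> nat \<Rightarrow> nat \<times> nat \<Rightarrow> 'a::field"
  where "elem_matrix m i j g = (\<lambda>st\<in>{..<m} \<times> {..<m}. if st = (i, j) then g else 0)"

context symbol_params begin

lemma mul_zero [simp]: "mul 0 f = 0" "mul f 0 = 0"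
  by (rule ext, simp add: mul_def cong: if_cong)+

lemma mul_sum_left: "mul (sum f S) g = (\<Sum>i\<in>S. mul (f i) g)"
proof (induction S rule: infinite_finite_induct)
  case (insert i S)
  then show ?case by (simp only: sum.insert[OF insert.hyps] mul_add_left)
qed (simp_all only: sum.infinite sum.empty mul_zero not_False_eq_True)

lemma mul_sum_right: "mul g (sum f S) = (\<Sum>i\<in>S. mul g (f i))"
proof (induction S rule: infinite_finite_induct)
  case (insert i S)
  then show ?case by (simp only: sum.insert[OF insert.hyps] mul_add_right)
qed (simp_all only: sum.infinite sum.empty mul_zero not_False_eq_True)

lemma zero_closed [simp]: "0 \<in> carrier A" by (simp add: carrier_iff)

lemma sum_closed:
  assumes "\<And>i. i \<in> S \<Longrightarrow> f i \<in> carrier A"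
  shows "sum f S \<in> carrier A"
  using assms by (induction S rule: infinite_finite_induct) (simp_all add: carrier_iff)

lemma finsum_A:
  assumes "finite S" "\<And>i. i \<in> S \<Longrightarrow> f i \<in> carrier A"
  shows "finsum A f S = sum f S"
proof -
  interpret A: abelian_group A by (rule abelian_group_A)
  show ?thesis using assms
  proof (induction S rule: finite_induct)
    case (insert i S)
    then show ?case by (simp add: A.finsum_insert Pi_def del: plus_fun_apply)
  qed simp
qed

abbreviation "MA n \<equiv> matrix_algebra n A"

lemma matrix_carrier: "carrier (MA n) = {..<n} \<times> {..<n} \<rightarrow>\<^sub>E carrier A"
  by (simp add: matrix_algebra_def Let_def)

lemma matrix_mult:
  "M \<otimes>\<^bsub>MA n\<^esub> N = (\<lambda>(i,j)\<in>{..<n} \<times> {..<n}. \<Sum>k<n. mul (M (i,k)) (N (k,j)))"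
proof -
  have "(\<Oplus>\<^bsub>A\<^esub>k\<in>{..<n}. M (i,k) \<otimes>\<^bsub>A\<^esub> N (k,j)) = (\<Sum>k<n. mul (M (i,k)) (N (k,j)))" for i j
    unfolding symbol_algebra_simps by (rule finsum_A[OF finite_lessThan mul_closed])
  then show ?thesis by (simp add: matrix_algebra_def Let_def)
qed

lemma matrix_simps:
  "\<one>\<^bsub>MA n\<^esub> = (\<lambda>(i,j)\<in>{..<n} \<times> {..<n}. if i = j then monomial (0,0) else 0)"
  "M \<oplus>\<^bsub>MA n\<^esub> N = (\<lambda>ij\<in>{..<n} \<times> {..<n}. M ij + N ij)"
  "c \<odot>\<^bsub>MA n\<^esub> M = (\<lambda>ij\<in>{..<n} \<times> {..<n}. (\<lambda>t. c * M ij t))"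
  by (simp_all add: matrix_algebra_def Let_def cong: if_cong)

lemma matrix_closed:
  "M \<in> carrier (MA n) \<Longrightarrow> N \<in> carrier (MA n) \<Longrightarrow> M \<otimes>\<^bsub>MA n\<^esub> N \<in> carrier (MA n)"
  "M \<in> carrier (MA n) \<Longrightarrow> N \<in> carrier (MA n) \<Longrightarrow> M \<oplus>\<^bsub>MA n\<^esub> N \<in> carrier (MA n)"
  "M \<in> carrier (MA n) \<Longrightarrow> c \<odot>\<^bsub>MA n\<^esub> M \<in> carrier (MA n)"
  "\<one>\<^bsub>MA n\<^esub> \<in> carrier (MA n)"
proof -
  have add_closed: "f + g \<in> carrier A" if "f \<in> carrier A" "g \<in> carrier A" for f g
    using that by (simp add: carrier_iff)
  assume M: "M \<in> carrier (MA n)"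
  then have Mc: "M ij \<in> carrier A" if "ij \<in> {..<n} \<times> {..<n}" for ij
    using that unfolding matrix_carrier by (rule PiE_mem)
  show "c \<odot>\<^bsub>MA n\<^esub> M \<in> carrier (MA n)"
    unfolding matrix_simps matrix_carrier restrict_PiE_iff by (intro ballI scale_closed Mc)
  assume N: "N \<in> carrier (MA n)"
  then have Nc: "N ij \<in> carrier A" if "ij \<in> {..<n} \<times> {..<n}" for ij
    using that unfolding matrix_carrier by (rule PiE_mem)
  show "M \<oplus>\<^bsub>MA n\<^esub> N \<in> carrier (MA n)"
    unfolding matrix_simps matrix_carrier restrict_PiE_iff by (intro ballI add_closed Mc Nc)
  show "M \<otimes>\<^bsub>MA n\<^esub> N \<in> carrier (MA n)"
    unfolding matrix_mult matrix_carrier restrict_PiE_iff split_def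
    by (intro ballI sum_closed mul_closed)
next
  show "\<one>\<^bsub>MA n\<^esub> \<in> carrier (MA n)"
    unfolding matrix_simps matrix_carrier restrict_PiE_iff split_def by simp
qed

lemma elem_closed [simp]: "g \<in> carrier A \<Longrightarrow> elem_matrix m i j g \<in> carrier (MA m)"
  by (auto simp: elem_matrix_def matrix_carrier)

lemma elem_mult:
  assumes "j < m" "k < m" "f \<in> carrier A" "g \<in> carrier A"
  shows "elem_matrix m i j f \<otimes>\<^bsub>MA m\<^esub> elem_matrix m k l g
    = elem_matrix m i l (if j = k then mul f g else 0)"
proof -
  have "(\<Sum>r<m. mul (elem_matrix m i j f (s,r)) (elem_matrix m k l g (r,t)))
      = (if (s,t) = (i,l) then (if j = k then mul f g else 0) else 0)" if "s < m" "t < m" for s t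
  proof -
    have "(\<Sum>r<m. mul (elem_matrix m i j f (s,r)) (elem_matrix m k l g (r,t)))
        = (\<Sum>r<m. if r = j then (if (s,t) = (i,l) \<and> j = k then mul f g else 0) else 0)"
      using that by (intro sum.cong refl) (auto simp: elem_matrix_def)
    also have "\<dots> = (if (s,t) = (i,l) then (if j = k then mul f g else 0) else 0)"
      using assms by simp
    finally show ?thesis .
  qed
  then show ?thesis
    unfolding matrix_mult elem_matrix_def[of m i l]
    by (intro restrict_ext) (simp only: split_paired_all mem_Times_iff fst_conv snd_conv lessThan_iff case_prod_conv)
qed

lemma elem_scale: "elem_matrix m i j (\<lambda>t. c * g t) = c \<odot>\<^bsub>MA m\<^esub> elem_matrix m i j g"
  by (auto simp: elem_matrix_def matrix_simps restrict_def fun_eq_iff)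

text \<open>Columns of length \<open>n\<close>, extended by zero.  Matrices act on them from the left and elements of the
algebra from the right.\<close>

definition vectors :: "nat \<Rightarrow> (nat \<Rightarrow> nat \<times> nat \<Rightarrow> 'a) set"
  where "vectors n = {x. (\<forall>i. x i \<in> carrier A) \<and> (\<forall>i\<ge>n. x i = 0)}"

definition mat_act ::
    "nat \<Rightarrow> (nat \<times> nat \<Rightarrow> nat \<times> nat \<Rightarrow> 'a) \<Rightarrow> (nat \<Rightarrow> nat \<times> nat \<Rightarrow> 'a) \<Rightarrow> nat \<Rightarrow> nat \<times> nat \<Rightarrow> 'a"
  where "mat_act n M x = (\<lambda>i. if i < n then \<Sum>k<n. mul (M (i,k)) (x k) else 0)"

definition right_mul :: "(nat \<times> nat \<Rightarrow> 'a) \<Rightarrow> (nat \<Rightarrow> nat \<times> nat \<Rightarrow> 'a) \<Rightarrow> nat \<Rightarrow> nat \<times> nat \<Rightarrow> 'a"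
  where "right_mul g x = (\<lambda>i. mul (x i) g)"

lemma subspace_vectors: "vec.subspace (vectors n)"
  by (auto simp: vec.subspace_def vectors_def vscale_def carrier_iff fun_eq_iff)

lemma dim_vectors: "dim_le vscale (vectors n) (n * (p * p))"
proof (rule vec.dim_le_span)
  let ?d = "\<lambda>(i,a). \<lambda>i' t. if i' = i \<and> t = a then 1 else 0 :: 'a"
  let ?D = "?d ` ({..<n} \<times> ind)"
  show "finite ?D" by simp
  have "card ?D \<le> card ({..<n} \<times> ind)" by (rule card_image_le) simp
  also have "\<dots> = n * (p * p)" by (simp add: ind_def card_cartesian_product)
  finally show "card ?D \<le> n * (p * p)" .
  show "vectors n \<subseteq> vec.span ?D"
  proof
    fix x assume x: "x \<in> vectors n"
    have "x = (\<Sum>ia\<in>{..<n} \<times> ind. vscale (x (fst ia) (snd ia)) (?d ia))"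
    proof (intro ext)
      fix i t
      have "(\<Sum>ia\<in>{..<n} \<times> ind. vscale (x (fst ia) (snd ia)) (?d ia)) i t
          = (\<Sum>ia\<in>{..<n} \<times> ind. if ia = (i,t) then x i t else 0)"
        unfolding sum_fun_apply by (intro sum.cong refl) (auto simp: vscale_def split_def prod_eq_iff)
      also have "\<dots> = (if (i,t) \<in> {..<n} \<times> ind then x i t else 0)" by simp
      also have "\<dots> = x i t"
      proof (cases "(i,t) \<in> {..<n} \<times> ind")
        case False
        then have "i \<ge> n \<or> t \<notin> ind" by auto
        then have "x i t = 0" using x carrier_iff[of "x i"] by (auto simp: vectors_def simp del: split_paired_All)
        then show ?thesis by simp
      qed simp
      finally show "x i t = (\<Sum>ia\<in>{..<n} \<times> ind. vscale (x (fst ia) (snd ia)) (?d ia)) i t" by simp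
    qed
    also have "\<dots> \<in> vec.span ?D"
      by (intro vec.span_sum vec.span_scale vec.span_base imageI)
    finally show "x \<in> vec.span ?D" .
  qed
qed

lemma mat_act_hom: "module_hom vscale vscale (mat_act n M)"
proof unfold_locales
  show "mat_act n M (x + y) = mat_act n M x + mat_act n M y" for x y
    by (rule ext) (simp add: mat_act_def mul_add_right sum.distrib)
  show "mat_act n M (vscale c x) = vscale c (mat_act n M x)" for c x
    by (intro ext) (simp add: mat_act_def vscale_def mul_scale_right sum_fun_apply sum_distrib_left)
qed

lemma right_mul_hom: "module_hom vscale vscale (right_mul g)"
  by unfold_locales (simp_all add: right_mul_def vscale_def fun_eq_iff mul_add_left mul_scale_left)

lemma mat_act_closed [simp]: "mat_act n M x \<in> vectors n"
  by (auto simp: mat_act_def vectors_def intro!: sum_closed)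

lemma right_mul_closed [simp]: "x \<in> vectors n \<Longrightarrow> right_mul g x \<in> vectors n"
  by (simp add: right_mul_def vectors_def)

lemma mat_act_right_mul: "mat_act n M (right_mul g x) = right_mul g (mat_act n M x)"
  by (rule ext) (simp add: mat_act_def right_mul_def mul_sum_left mul_assoc)

lemma right_mul_right_mul: "right_mul g (right_mul f x) = right_mul (mul f g) x"
  by (simp add: right_mul_def mul_assoc)

lemma right_mul_scale: "right_mul (\<lambda>t. c * g t) x = vscale c (right_mul g x)"
  by (simp add: right_mul_def vscale_def mul_scale_right)

lemma right_mul_one: "x \<in> vectors n \<Longrightarrow> right_mul (monomial (0,0)) x = x"
  by (auto simp: right_mul_def vectors_def)

lemma right_mul_power: "x \<in> vectors n \<Longrightarrow> (right_mul g ^^ k) x = right_mul (mul_power g k) x"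
proof (induction k arbitrary: x)
  case (Suc k)
  have "(right_mul g ^^ Suc k) x = (right_mul g ^^ k) (right_mul g x)" by (simp add: funpow_swap1)
  also have "\<dots> = right_mul (mul_power g (Suc k)) x"
    using Suc by (simp add: right_mul_right_mul)
  finally show ?case .
qed (simp add: right_mul_one)

lemma mat_act_mult:
  assumes "M \<in> carrier (MA n)" "N \<in> carrier (MA n)"
  shows "mat_act n (M \<otimes>\<^bsub>MA n\<^esub> N) x = mat_act n M (mat_act n N x)"
proof
  fix i
  show "mat_act n (M \<otimes>\<^bsub>MA n\<^esub> N) x i = mat_act n M (mat_act n N x) i"
  proof (cases "i < n")
    case True
    then have "mat_act n (M \<otimes>\<^bsub>MA n\<^esub> N) x i = (\<Sum>k<n. \<Sum>l<n. mul (mul (M (i,l)) (N (l,k))) (x k))"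
      by (simp add: mat_act_def matrix_mult mul_sum_left)
    also have "\<dots> = (\<Sum>l<n. \<Sum>k<n. mul (M (i,l)) (mul (N (l,k)) (x k)))"
      by (subst sum.swap) (simp add: mul_assoc)
    finally show ?thesis using True by (simp add: mat_act_def mul_sum_right)
  qed (simp add: mat_act_def)
qed

lemma mat_act_scale: "mat_act n (c \<odot>\<^bsub>MA n\<^esub> M) x = vscale c (mat_act n M x)"
  by (intro ext) (simp add: mat_act_def matrix_simps vscale_def mul_scale_left sum_fun_apply sum_distrib_left)

text \<open>Tested on the unit columns.\<close>

lemma mat_act_faithful:
  assumes "M \<in> carrier (MA n)" "\<And>x. x \<in> vectors n \<Longrightarrow> mat_act n M x = 0" "i < n" "k < n"
  shows "M (i,k) = 0"
proof -
  define x where "x = (\<lambda>l. if l = k then monomial (0,0) else 0)"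
  have "x \<in> vectors n" using assms by (auto simp: x_def vectors_def)
  then have "mat_act n M x i = 0" using assms(2) by simp
  moreover have "mat_act n M x i = (\<Sum>l<n. if l = k then M (i,k) else 0)"
  proof -
    have "mul (M (i,l)) (x l) = (if l = k then M (i,k) else 0)" if "l < n" for l
    proof -
      have "M (i,k) \<in> carrier A" using assms by (auto simp: matrix_carrier)
      then show ?thesis by (simp add: x_def)
    qed
    then show ?thesis using assms(3) by (simp add: mat_act_def)
  qed
  ultimately show ?thesis using assms by simp
qed

end

lemma matrix_algebra_isomorphic_sym:
  assumes A: "symbol_params p \<zeta> u v"
    and iso: "algebra_isomorphic (matrix_algebra m (symbol_algebra p \<zeta> u v)) B"
  shows "algebra_isomorphic B (matrix_algebra m (symbol_algebra p \<zeta> u v))"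
proof -
  interpret symbol_params p \<zeta> u v by fact
  obtain h where h: "h \<in> ring_iso (MA m) B"
    and sc: "\<And>c x. x \<in> carrier (MA m) \<Longrightarrow> h (c \<odot>\<^bsub>MA m\<^esub> x) = c \<odot>\<^bsub>B\<^esub> h x"
    using iso unfolding algebra_isomorphic_def by blast
  have hom: "h \<in> Ring.ring_hom (MA m) B" and bij: "bij_betw h (carrier (MA m)) (carrier B)"
    using h by (auto simp: ring_iso_def)
  let ?g = "inv_into (carrier (MA m)) h"
  have gc: "?g y \<in> carrier (MA m)" if "y \<in> carrier B" for y
    using bij_betwE[OF bij_betw_inv_into[OF bij]] that by blast
  have hg: "h (?g y) = y" if "y \<in> carrier B" for y
    by (rule bij_betw_inv_into_right[OF bij that])
  have eq: "?g z = x" if "h x = z" "x \<in> carrier (MA m)" for x z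
    using bij_betw_inv_into_left[OF bij that(2)] that(1) by simp
  have "?g \<in> ring_iso B (MA m)"
    unfolding ring_iso_def
  proof (rule CollectI, rule conjI, rule ring_hom_memI)
    show "bij_betw ?g (carrier B) (carrier (MA m))" using bij by (rule bij_betw_inv_into)
    fix x y assume xy: "x \<in> carrier B" "y \<in> carrier B"
    note g = gc[OF xy(1)] gc[OF xy(2)]
    show "?g (x \<otimes>\<^bsub>B\<^esub> y) = ?g x \<otimes>\<^bsub>MA m\<^esub> ?g y"
      by (rule eq[OF _ matrix_closed(1)[OF g]]) (simp only: ring_hom_mult[OF hom g] hg xy)
    show "?g (x \<oplus>\<^bsub>B\<^esub> y) = ?g x \<oplus>\<^bsub>MA m\<^esub> ?g y"
      by (rule eq[OF _ matrix_closed(2)[OF g]]) (simp only: ring_hom_add[OF hom g] hg xy)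
  next
    show "?g \<one>\<^bsub>B\<^esub> = \<one>\<^bsub>MA m\<^esub>"
      by (rule eq[OF _ matrix_closed(4)]) (rule ring_hom_one[OF hom])
  qed (rule gc)
  moreover have "?g (c \<odot>\<^bsub>B\<^esub> y) = c \<odot>\<^bsub>MA m\<^esub> ?g y" if "y \<in> carrier B" for c y
    by (rule eq[OF _ matrix_closed(3)[OF gc[OF that]]]) (simp only: sc[OF gc[OF that]] hg[OF that])
  ultimately show ?thesis unfolding algebra_isomorphic_def by (intro bexI[of _ ?g] allI ballI)
qed

section \<open>Brauer equivalence of two symbols\<close>

text \<open>\<open>G i j g\<close> is the action on columns over \<open>B\<close> of the matrix over \<open>A\<close> with the single entry \<open>g\<close>,
transported by the isomorphism, and \<open>W\<close> is the image of the idempotent \<open>G 0 0 1\<close>.  The maps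
\<open>G t 0 1\<close>, for \<open>t < m\<close>, embed \<open>m\<close> independent copies of \<open>W\<close> into the columns, a space of dimension
\<open>n p\<^sup>2 \<le> m p\<^sup>2\<close>.  The right action reverses products, which is why the second pair has the inverse
root of unity.\<close>

lemma symbol_bimodule:
  fixes \<zeta> u v u' v' :: "'a::field"
  assumes "symbol_params p \<zeta> u v" "symbol_params p \<zeta> u' v'"
    and iso: "algebra_isomorphic (matrix_algebra m (symbol_algebra p \<zeta> u v))
      (matrix_algebra n (symbol_algebra p \<zeta> u' v'))"
    and mn: "m > 0" "n \<le> m"
  obtains W x0 P Q R S where "vec.subspace W" "dim_le vscale W (p * p)" "x0 \<in> W" "x0 \<noteq> 0"
    "symbol_pair vscale p W \<zeta> u v P Q" "symbol_pair vscale p W (inverse \<zeta>) u' v' R S"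
    "commute_on W P R" "commute_on W P S" "commute_on W Q R" "commute_on W Q S"
proof -
  interpret A: symbol_params p \<zeta> u v by fact
  interpret B: symbol_params p \<zeta> u' v' by fact
  obtain h where h: "h \<in> ring_iso (A.MA m) (B.MA n)"
    and sc: "\<And>c x. x \<in> carrier (A.MA m) \<Longrightarrow> h (c \<odot>\<^bsub>A.MA m\<^esub> x) = c \<odot>\<^bsub>B.MA n\<^esub> h x"
    using iso unfolding algebra_isomorphic_def by blast
  have hom: "h \<in> Ring.ring_hom (A.MA m) (B.MA n)" and bij: "bij_betw h (carrier (A.MA m)) (carrier (B.MA n))"
    using h by (auto simp: ring_iso_def)
  have hc: "h M \<in> carrier (B.MA n)" if "M \<in> carrier (A.MA m)" for M
    using bij_betwE[OF bij] that by blast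
  define G where "G i j g = B.mat_act n (h (elem_matrix m i j g))" for i j g
  have Gvec: "G i j g x \<in> B.vectors n" for i j g x by (simp add: G_def)
  have Ghom: "module_hom vscale vscale (G i j g)" for i j g
    unfolding G_def by (rule B.mat_act_hom)
  have Gsc: "G i j (\<lambda>t. c * g t) x = vscale c (G i j g x)" if "g \<in> carrier A.A" for i j c g x
    unfolding G_def A.elem_scale by (simp only: sc[OF A.elem_closed[OF that]] B.mat_act_scale)
  have G0: "G i j 0 x = 0" for i j x
    using Gsc[of 0 i j 0 x] A.zero_closed by (simp add: zero_fun_def[symmetric] vec.scale_zero_left)
  have Gmul: "G i j f (G k l g x) = (if j = k then G i l (A.mul f g) x else 0)"
    if "j < m" "k < m" "f \<in> carrier A.A" "g \<in> carrier A.A" for i j k l f g x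
  proof -
    have "G i j f (G k l g x) = B.mat_act n (h (elem_matrix m i j f \<otimes>\<^bsub>A.MA m\<^esub> elem_matrix m k l g)) x"
      unfolding G_def ring_hom_mult[OF hom A.elem_closed[OF that(3)] A.elem_closed[OF that(4)]]
      by (rule B.mat_act_mult[symmetric]) (intro hc A.elem_closed that)+
    also have "\<dots> = G i l (if j = k then A.mul f g else 0) x"
      by (simp only: A.elem_mult[OF that] G_def)
    finally show ?thesis using G0 by simp
  qed
  let ?one = "A.monomial (0,0)"
  have one: "?one \<in> carrier A.A" by simp
  define W where "W = {x \<in> B.vectors n. G 0 0 ?one x = x}"
  interpret G1: module_hom vscale vscale "G 0 0 ?one" by (rule Ghom)
  have W: "vec.subspace W"
    using B.subspace_vectors[of n]
    by (auto simp: vec.subspace_def W_def G1.zero G1.add G1.scale)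
  have GW: "G 0 0 g x \<in> W" if "g \<in> carrier A.A" for g x
    using Gvec Gmul[where i=0 and j=0 and k=0 and l=0 and f="?one" and g=g] mn that by (simp add: W_def)
  have GG: "G 0 0 f (G 0 0 g x) = G 0 0 (A.mul f g) x" if "f \<in> carrier A.A" "g \<in> carrier A.A" for f g x
    using Gmul[where i=0 and j=0 and k=0 and l=0 and f=f and g=g] mn that by simp
  \<comment> \<open>The idempotent acts as a nonzero operator, because the action on columns is faithful and the
    isomorphism is injective.\<close>
  obtain x0 where x0: "x0 \<in> W" "x0 \<noteq> 0"
  proof -
    have "\<exists>x. G 0 0 ?one x \<noteq> 0"
    proof (rule ccontr)
      assume "\<not> ?thesis"
      then have z: "B.mat_act n (h (elem_matrix m 0 0 ?one)) x = 0" for x by (simp add: G_def)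
      let ?M = "elem_matrix m 0 0 ?one"
      have z2: "h ?M (i,k) = 0" if "i < n" "k < n" for i k
        by (rule B.mat_act_faithful[OF hc[OF A.elem_closed[OF one]] z that])
      have "h (0 \<odot>\<^bsub>A.MA m\<^esub> ?M) = 0 \<odot>\<^bsub>B.MA n\<^esub> h ?M" by (rule sc[OF A.elem_closed[OF one]])
      also have "\<dots> = h ?M"
      proof (rule PiE_ext)
        show "h ?M \<in> {..<n} \<times> {..<n} \<rightarrow>\<^sub>E carrier B.A"
          using hc[OF A.elem_closed[OF one]] unfolding B.matrix_carrier .
        show "0 \<odot>\<^bsub>B.MA n\<^esub> h ?M \<in> {..<n} \<times> {..<n} \<rightarrow>\<^sub>E carrier B.A"
          using B.matrix_closed(3)[OF hc[OF A.elem_closed[OF one]]] unfolding B.matrix_carrier .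
        fix ij assume "ij \<in> {..<n} \<times> {..<n}"
        then show "(0 \<odot>\<^bsub>B.MA n\<^esub> h ?M) ij = h ?M ij"
          using z2[of "fst ij" "snd ij"] by (auto simp: B.matrix_simps zero_fun_def)
      qed
      finally have "0 \<odot>\<^bsub>A.MA m\<^esub> ?M = ?M"
        using bij A.elem_closed[OF one] A.matrix_closed(3)[OF A.elem_closed[OF one]]
        by (meson bij_betw_def inj_onD)
      then have "(0 \<odot>\<^bsub>A.MA m\<^esub> ?M) (0,0) (0,0) = ?M (0,0) (0,0)" by simp
      then show False using mn by (simp add: A.matrix_simps elem_matrix_def A.monomial_def)
    qed
    then show ?thesis using GW[OF one] that by blast
  qed
  have dimW: "dim_le vscale W (p * p)"
  proof (rule vec.dim_le_direct_sum[OF B.dim_vectors[of n] W, of "{..<m}" "\<lambda>t. G t 0 ?one"])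
    show "n * (p * p) < card {..<m} * Suc (p * p)"
      using mn(1) mult_le_mono1[OF mn(2), of "p * p"] by (simp only: card_lessThan mult_Suc_right)
    fix g assume g: "\<And>t. t \<in> {..<m} \<Longrightarrow> g t \<in> W" "(\<Sum>t<m. G t 0 ?one (g t)) = 0"
    show "\<forall>t\<in>{..<m}. g t = 0"
    proof
      fix s assume s: "s \<in> {..<m}"
      interpret Gs: module_hom vscale vscale "G 0 s ?one" by (rule Ghom)
      have "0 = G 0 s ?one (\<Sum>t<m. G t 0 ?one (g t))" by (simp only: g(2) Gs.zero)
      also have "\<dots> = (\<Sum>t<m. if t = s then G 0 0 ?one (g s) else 0)"
        unfolding Gs.sum using s by (intro sum.cong refl) (simp add: Gmul)
      also have "\<dots> = g s" using s g(1)[OF s] by (simp add: W_def)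
      finally show "g s = 0" by simp
    qed
  qed (use Ghom Gvec in auto)
  let ?P = "G 0 0 A.gen_i" and ?Q = "G 0 0 A.gen_j"
  let ?R = "B.right_mul B.gen_i" and ?S = "B.right_mul B.gen_j"
  have gens: "A.gen_i \<in> carrier A.A" "A.gen_j \<in> carrier A.A" by simp_all
  have Gpow: "(G 0 0 g ^^ k) x = G 0 0 (A.mul_power g k) x" if "x \<in> W" "g \<in> carrier A.A" for g k x
  proof (induction k)
    case 0
    then show ?case using that by (simp add: W_def)
  next
    case (Suc k)
    have "A.mul_power g k \<in> carrier A.A" by (cases k) simp_all
    then show ?case using Suc that by (simp add: GG)
  qed
  have Gone: "G 0 0 ?one x = x" if "x \<in> W" for x using that by (simp add: W_def)
  have pair1: "symbol_pair vscale p W \<zeta> u v ?P ?Q"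
    unfolding symbol_pair_def
  proof (intro conjI ballI Ghom)
    show "?P ` W \<subseteq> W" "?Q ` W \<subseteq> W" using GW gens by auto
    fix x assume x: "x \<in> W"
    show "?Q (?P x) = vscale \<zeta> (?P (?Q x))"
      by (simp only: GG[OF gens(2,1)] GG[OF gens(1,2)] A.gen_j_gen_i Gsc[OF A.mul_closed])
    show "(?P ^^ p) x = vscale u x" "(?Q ^^ p) x = vscale v x"
      by (simp_all only: Gpow[OF x gens(1)] Gpow[OF x gens(2)] A.gen_i_power A.gen_j_power Gsc[OF one] Gone[OF x])
  qed
  have RW: "B.right_mul g x \<in> W" if "x \<in> W" for g x
    using that B.mat_act_right_mul[of n _ g x] by (simp add: W_def G_def)
  have pair2: "symbol_pair vscale p W (inverse \<zeta>) u' v' ?R ?S"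
    unfolding symbol_pair_def
  proof (intro conjI ballI B.right_mul_hom)
    show "?R ` W \<subseteq> W" "?S ` W \<subseteq> W" using RW by auto
    fix x assume x: "x \<in> W"
    then have xv: "x \<in> B.vectors n" by (simp add: W_def)
    show "?S (?R x) = vscale (inverse \<zeta>) (?R (?S x))"
      using primitive_root_nonzero[OF A.zeta]
      by (simp add: B.right_mul_right_mul B.gen_j_gen_i B.right_mul_scale)
    show "(?R ^^ p) x = vscale u' x" "(?S ^^ p) x = vscale v' x"
      by (simp_all only: B.right_mul_power[OF xv] B.gen_i_power B.gen_j_power B.right_mul_scale B.right_mul_one[OF xv])
  qed
  have com: "commute_on W (G 0 0 g) (B.right_mul f)" for g f
    by (simp add: commute_on_def G_def B.mat_act_right_mul)
  show ?thesis by (rule that[OF W dimW x0 pair1 pair2 com com com com])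
qed

lemma symbol_eq_imp_isomorphic:
  fixes \<zeta> u v u' v' :: "'a::field"
  assumes A: "symbol_params p \<zeta> u v" and B: "symbol_params p \<zeta> u' v'"
    and eq: "symbol p \<zeta> u v = symbol p \<zeta> u' v'"
  obtains m n where "m > 0" "n > 0"
    "algebra_isomorphic (matrix_algebra m (symbol_algebra p \<zeta> u v))
      (matrix_algebra n (symbol_algebra p \<zeta> u' v'))"
proof -
  have refl: "algebra_isomorphic M M" for M :: "('a, 'b) module"
  proof -
    have "id \<in> ring_iso M M" by (auto simp: ring_iso_def ring_hom_def)
    then show ?thesis unfolding algebra_isomorphic_def by (intro bexI[of _ id]) simp_all
  qed
  have "central_simple_algebra (symbol_algebra p \<zeta> u' v')"
    by (rule symbol_params.central_simple_A[OF B])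
  then have "(symbol_algebra p \<zeta> u' v', symbol_algebra p \<zeta> u' v') \<in> brauer_rel"
    using refl unfolding brauer_rel_def by blast
  then have "symbol_algebra p \<zeta> u' v' \<in> symbol p \<zeta> u v"
    unfolding eq by (simp add: symbol_def brauer_class_def)
  then show ?thesis using that by (auto simp: symbol_def brauer_class_def brauer_rel_def)
qed

text \<open>The bimodule is small for one of the two directions of the isomorphism; the other direction
exchanges the two actions and replaces \<open>\<zeta>\<close> by its inverse.\<close>

lemma equal_symbols_commuting_pairs:
  fixes \<zeta> u v u' v' :: "'a::field"
  assumes A: "symbol_params p \<zeta> u v" and B: "symbol_params p \<zeta> u' v'"
    and eq: "symbol p \<zeta> u v = symbol p \<zeta> u' v'"
  obtains W x0 P Q R S and \<omega> :: 'a where "primitive_root_of_unity p \<omega>"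
    "vec.subspace W" "dim_le vscale W (p * p)" "x0 \<in> W" "x0 \<noteq> 0"
    "symbol_pair vscale p W \<omega> u v P Q" "symbol_pair vscale p W (inverse \<omega>) u' v' R S"
    "commute_on W P R" "commute_on W P S" "commute_on W Q R" "commute_on W Q S"
proof -
  have z: "primitive_root_of_unity p \<zeta>" using A by (simp add: symbol_params_def)
  obtain m n where mn: "m > 0" "n > 0"
    and iso: "algebra_isomorphic (matrix_algebra m (symbol_algebra p \<zeta> u v))
      (matrix_algebra n (symbol_algebra p \<zeta> u' v'))"
    by (rule symbol_eq_imp_isomorphic[OF A B eq])
  show ?thesis
  proof (cases "n \<le> m")
    case True
    show ?thesis
      by (rule symbol_bimodule[OF A B iso mn(1) True], rule that[OF z])
  next
    case False
    then have le: "m \<le> n" by simp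
    obtain W x0 P Q R S where *: "vec.subspace W" "dim_le vscale W (p * p)" "x0 \<in> W" "x0 \<noteq> 0"
      "symbol_pair vscale p W \<zeta> u' v' P Q" "symbol_pair vscale p W (inverse \<zeta>) u v R S"
      "commute_on W P R" "commute_on W P S" "commute_on W Q R" "commute_on W Q S"
      by (rule symbol_bimodule[OF B A matrix_algebra_isomorphic_sym[OF A iso] mn(2) le])
    have c: "commute_on W R P" "commute_on W S P" "commute_on W R Q" "commute_on W S Q"
      using *(7-10) by (auto simp: commute_on_def)
    have "symbol_pair vscale p W (inverse (inverse \<zeta>)) u' v' P Q" using *(5) by simp
    then show ?thesis
      using that[OF primitive_root_inverse[OF z] *(1-4,6) _ c(1,3,2,4)] by blast
  qed
qed

text \<open>Since \<open>(u\<^sup>-\<^sup>1, v') = - (u, v')\<close>, the hypothesis says that \<open>(u, v v')\<close> is split.\<close>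

lemma inverse_slot_norms:
  fixes \<zeta> u v v' :: "'a::field"
  assumes p: "prime p" "p \<noteq> CHAR('a)" and zeta: "primitive_root_of_unity p \<zeta>"
    and nz: "u \<noteq> 0" "v \<noteq> 0" "v' \<noteq> 0"
    and eq: "symbol p \<zeta> u v = symbol p \<zeta> (inverse u) v'"
  shows "v * v' \<in> norm_group (root_extension p u)"
    and "inverse u \<in> norm_group (root_extension p (v * v'))"
proof -
  have AB: "symbol_params p \<zeta> u v" "symbol_params p \<zeta> (inverse u) v'"
    using p zeta nz by (simp_all add: symbol_params_def)
  obtain W x0 P Q R S \<omega> where *: "primitive_root_of_unity p \<omega>"
    "vec.subspace W" "dim_le vscale W (p * p)" "x0 \<in> W" "x0 \<noteq> 0"
    "symbol_pair vscale p W \<omega> u v P Q" "symbol_pair vscale p W (inverse \<omega>) (inverse u) v' R S"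
    "commute_on W P R" "commute_on W P S" "commute_on W Q R" "commute_on W Q S"
    by (rule equal_symbols_commuting_pairs[OF AB eq])
  show "v * v' \<in> norm_group (root_extension p u)"
    by (rule vec.norm_of_commuting_pairs(1)[OF p * nz])
  show "inverse u \<in> norm_group (root_extension p (v * v'))"
    by (rule vec.norm_of_commuting_pairs(2)[OF p * nz])
qed

text \<open>The hypothesis says that \<open>(u / u', v)\<close> is split.  To cancel \<open>v\<close> against itself, the second pair is
replaced by its inverse, and both pairs are read with their operators exchanged.\<close>

lemma equal_slot_norms:
  fixes \<zeta> u u' v :: "'a::field"
  assumes p: "prime p" "p \<noteq> CHAR('a)" and zeta: "primitive_root_of_unity p \<zeta>"
    and nz: "u \<noteq> 0" "u' \<noteq> 0" "v \<noteq> 0"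
    and eq: "symbol p \<zeta> u v = symbol p \<zeta> u' v"
  shows "u * inverse u' \<in> norm_group (root_extension p v)"
    and "inverse v \<in> norm_group (root_extension p (u * inverse u'))"
proof -
  have AB: "symbol_params p \<zeta> u v" "symbol_params p \<zeta> u' v"
    using p zeta nz by (simp_all add: symbol_params_def)
  obtain W x0 P Q R S \<omega> where *: "primitive_root_of_unity p \<omega>"
    "vec.subspace W" "dim_le vscale W (p * p)" "x0 \<in> W" "x0 \<noteq> 0"
    "symbol_pair vscale p W \<omega> u v P Q" "symbol_pair vscale p W (inverse \<omega>) u' v R S"
    "commute_on W P R" "commute_on W P S" "commute_on W Q R" "commute_on W Q S"
    by (rule equal_symbols_commuting_pairs[OF AB eq])
  have \<omega>0: "\<omega> \<noteq> 0" "inverse \<omega> \<noteq> 0" using primitive_root_nonzero[OF *(1)] by auto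
  have p0: "p > 0" using p by (simp add: prime_gt_0_nat)
  have img: "P ` W \<subseteq> W" "Q ` W \<subseteq> W" using *(6) by (auto simp: symbol_pair_def)
  have QP: "symbol_pair vscale p W (inverse \<omega>) v u Q P"
    by (rule vec.symbol_pair_swap[OF *(6) \<omega>0(1)])
  have SR: "symbol_pair vscale p W (inverse (inverse \<omega>)) v u' S R"
    by (rule vec.symbol_pair_swap[OF *(7) \<omega>0(2)])
  obtain S' R' where inv: "symbol_pair vscale p W (inverse (inverse \<omega>)) (inverse v) (inverse u') S' R'"
    "\<And>f. f ` W \<subseteq> W \<Longrightarrow> commute_on W f S \<Longrightarrow> commute_on W f S'"
    "\<And>f. f ` W \<subseteq> W \<Longrightarrow> commute_on W f R \<Longrightarrow> commute_on W f R'"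
    using vec.symbol_pair_inverse[OF *(2) p0 _ nz(3,2) SR] \<omega>0 by auto
  have com: "commute_on W Q S'" "commute_on W Q R'" "commute_on W P S'" "commute_on W P R'"
    using inv(2,3) img * by auto
  have nz': "inverse u' \<noteq> 0" using nz by simp
  note norms = vec.norm_of_commuting_pairs[OF p primitive_root_inverse[OF *(1)] *(2-5) QP inv(1) com nz(3,1) nz']
  show "u * inverse u' \<in> norm_group (root_extension p v)" by (rule norms(1))
  show "inverse v \<in> norm_group (root_extension p (u * inverse u'))" by (rule norms(2))
qed

theorem mainTheorem2:
  fixes a b c d x y \<zeta> :: "'F::field" and p :: nat
  assumes "global_field TYPE('F)"
    and "prime p" and "odd p" and "p \<noteq> CHAR('F)"
    and "primitive_root_of_unity p \<zeta>"
    and "a \<noteq> 0" and "b \<noteq> 0" and "c \<noteq> 0" and "d \<noteq> 0" and "x \<noteq> 0" and "y \<noteq> 0"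
    and "symbol p \<zeta> a b = symbol p \<zeta> (inverse x) b"
    and "symbol p \<zeta> (inverse x) b = symbol p \<zeta> x y"
    and "symbol p \<zeta> x y = symbol p \<zeta> (inverse c) y"
    and "symbol p \<zeta> (inverse c) y = symbol p \<zeta> c d"
  shows "a * x \<in> norm_group (root_extension p b) \<and>
         inverse x \<in> norm_group (root_extension p (b * y)) \<and>
         inverse y \<in> norm_group (root_extension p (x * c)) \<and>
         y * d \<in> norm_group (root_extension p c)"
proof (intro conjI)
  note p = assms(2,4,5)
  have nz: "inverse x \<noteq> 0" "inverse c \<noteq> 0" using assms(8,10) by simp_all
  show "a * x \<in> norm_group (root_extension p b)"
    using equal_slot_norms(1)[OF p assms(6) nz(1) assms(7,12)] by simp
  show "inverse x \<in> norm_group (root_extension p (b * y))"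
    using inverse_slot_norms(2)[OF p assms(10,11,7) assms(13)[symmetric]] by (simp add: mult.commute)
  show "inverse y \<in> norm_group (root_extension p (x * c))"
    using equal_slot_norms(2)[OF p assms(10) nz(2) assms(11,14)] by simp
  show "y * d \<in> norm_group (root_extension p c)"
    using inverse_slot_norms(1)[OF p assms(8,9,11) assms(15)[symmetric]] by (simp add: mult.commute)
qed

end
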